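(* Let $F\in\Gamma^{p\times q}$, $F(z)=\sum_{n=0}^\infty z^nf_n$. The following are equivalent: (1) Every entry of $F$ can be obtained by a finite number of additions, $\star$-multiplications and $\star$-inversions starting from constants in $\overline{\Lambda}^{(1)}$ and the variable $z$. (2) $F(z)=M_1(z)\star M_2(z)^{-\star}\star M_3(z)$ for some integer $m\ge1$ and some polynomials $M_1\in\Gamma^{p\times m}$, $M_2\in\Gamma^{m\times m}$, $M_3\in\Gamma^{m\times q}$, with $M_2(0)$ invertible. (3) $F$ admits a realization, i.e. $F(z)=D+zC\star(I_N-zA)^{-\star}B$ for some $N$ and some matrices $A,B,C,D$ with entries in $\overline{\Lambda}^{(1)}$ of sizes $N\times N$, $N\times q$, $p\times N$, $p\times q$. (4) There exist $N$ and matrices $A,B,C,D$ with entries in $\overline{\Lambda}^{(1)}$ of sizes $N\times N$, $N\times q$, $p\times N$, $p\times q$, such that $f_0=D$ and $f_n=CA^{n-1}B$ for all $n\ge1$. (5) The right $\overline{\Lambda}^{(1)}$-module spanned by the functions $R_0^nFc$, where $n$ runs through $\mathbb{N}=\{1,2,\ldots\}$ and $c$ runs through $(\overline{\Lambda}^{(1)})^{q}$, is finitely generated.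
   Context: $\Lambda$ is the unital complex algebra generated by $1$ and countably many elements $i_1,i_2,\ldots$, linearly independent over $\mathbb{C}$, with $i_ni_m+i_mi_n=0$ for all $n,m$ (so $i_n^2=0$). With $i_\alpha=i_{a_1}\cdots i_{a_t}$ for finite strictly increasing tuples $\alpha=(a_1<\cdots<a_t)$ of positive integers, and $i_0=1$, $\overline{\Lambda}^{(1)}$ is the Banach algebra of all sums $z=\sum_\alpha z_\alpha i_\alpha$, $z_\alpha\in\mathbb{C}$, with $\|z\|_1=\sum_\alpha|z_\alpha|<\infty$. $\Gamma^{p\times q}$ denotes the power series $F(z)=\sum_{n=0}^\infty z^nf_n$ with $f_n\in(\overline{\Lambda}^{(1)})^{p\times q}$ converging for $z\in\overline{\Lambda}^{(1)}$ in a neighborhood of the origin; $\Gamma=\Gamma^{1\times1}$. The star (Cauchy) product of two such series (of compatible sizes) is $(F\star G)(z)=\sum_{n}z^n\big(\sum_{u=0}^{n}f_ug_{n-u}\big)$. $F^{-\star}$ denotes the inverse of $F$ for $\star$, which is used for square series whose constant coefficient is invertible. A polynomial is a finite sum $M_0+zM_1+\cdots+z^kM_k$ with coefficient matrices over $\overline{\Lambda}^{(1)}$. Here $zC$ denotes the polynomial with single coefficient $C$ at $z^1$. The backward-shift operator is $R_0F(z)=f_1+zf_2+z^2f_3+\cdots$. For a column $c$, $Fc=\sum z^nf_nc$, and the right action of $\overline{\Lambda}^{(1)}$ on power series is by right multiplication of the coefficients. *)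

theory Defs
  imports "HOL-Analysis.Infinite_Sum" "Jordan_Normal_Form.Matrix"
begin

section \<open>The Banach algebra of absolutely summable Grassmann series\<close>

text \<open>The strictly increasing tuple \<open>a\<^sub>1 < \<dots> < a\<^sub>t\<close> of positive integers is encoded by the
  finite set \<open>{a\<^sub>1 - 1, \<dots>, a\<^sub>t - 1}\<close> of natural numbers, i.e. the generators are numbered from
  \<open>0\<close> instead of \<open>1\<close>. A series \<open>z\<close> is given by its family of coefficients \<open>z\<^sub>\<alpha>\<close>, extended by
  zero to the infinite sets.\<close>

typedef grassmann =
  "{z :: nat set \<Rightarrow> complex. (\<forall>\<alpha>. infinite \<alpha> \<longrightarrow> z \<alpha> = 0) \<and> z abs_summable_on UNIV}"
  morphisms gcoeff Abs_grassmann
  by (rule exI[of _ "\<lambda>_. 0"]) simp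

setup_lifting type_definition_grassmann

text \<open>Number of transpositions needed to sort the concatenation of \<open>\<alpha>\<close> and \<open>\<beta>\<close>; for disjoint
  \<open>\<alpha>\<close> and \<open>\<beta>\<close> one has \<open>i\<^sub>\<alpha> i\<^sub>\<beta> = (-1)^n i\<^bsub>\<alpha> \<union> \<beta>\<^esub>\<close> with this number \<open>n\<close>, otherwise
  \<open>i\<^sub>\<alpha> i\<^sub>\<beta> = 0\<close>.\<close>

definition inversions :: "nat set \<Rightarrow> nat set \<Rightarrow> nat" where
  "inversions \<alpha> \<beta> = card {(a, b). a \<in> \<alpha> \<and> b \<in> \<beta> \<and> b < a}"

definition gsign :: "nat set \<Rightarrow> nat set \<Rightarrow> complex" where
  "gsign \<alpha> \<beta> = (-1) ^ inversions \<alpha> \<beta>"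

lemma norm_gsign [simp]: "norm (gsign \<alpha> \<beta>) = 1"
  by (simp add: gsign_def norm_power)

lemma inversions_finite:
  assumes "finite \<alpha>" "finite \<beta>"
  shows "finite {(a, b). a \<in> \<alpha> \<and> b \<in> \<beta> \<and> b < a}"
  by (rule finite_subset[of _ "\<alpha> \<times> \<beta>"]) (use assms in auto)

lemma gsign_empty [simp]: "gsign {} \<beta> = 1" "gsign \<alpha> {} = 1"
  by (simp_all add: gsign_def inversions_def)

lemma inversions_Un_left:
  assumes "finite \<alpha>" "finite \<beta>" "finite \<gamma>" "\<alpha> \<inter> \<beta> = {}"
  shows "inversions (\<alpha> \<union> \<beta>) \<gamma> = inversions \<alpha> \<gamma> + inversions \<beta> \<gamma>"
proof -
  have "{(a, b). a \<in> \<alpha> \<union> \<beta> \<and> b \<in> \<gamma> \<and> b < a} =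
      {(a, b). a \<in> \<alpha> \<and> b \<in> \<gamma> \<and> b < a} \<union> {(a, b). a \<in> \<beta> \<and> b \<in> \<gamma> \<and> b < a}"
    by auto
  then show ?thesis unfolding inversions_def
    by (simp only:, subst card_Un_disjoint) (use assms inversions_finite in auto)
qed

lemma inversions_Un_right:
  assumes "finite \<alpha>" "finite \<beta>" "finite \<gamma>" "\<beta> \<inter> \<gamma> = {}"
  shows "inversions \<alpha> (\<beta> \<union> \<gamma>) = inversions \<alpha> \<beta> + inversions \<alpha> \<gamma>"
proof -
  have "{(a, b). a \<in> \<alpha> \<and> b \<in> \<beta> \<union> \<gamma> \<and> b < a} =
      {(a, b). a \<in> \<alpha> \<and> b \<in> \<beta> \<and> b < a} \<union> {(a, b). a \<in> \<alpha> \<and> b \<in> \<gamma> \<and> b < a}"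
    by auto
  then show ?thesis unfolding inversions_def
    by (simp only:, subst card_Un_disjoint) (use assms inversions_finite in auto)
qed

lemma gsign_cocycle:
  assumes "finite \<alpha>" "finite \<beta>" "finite \<gamma>" "\<alpha> \<inter> \<beta> = {}" "\<beta> \<inter> \<gamma> = {}"
  shows "gsign \<alpha> \<beta> * gsign (\<alpha> \<union> \<beta>) \<gamma> = gsign \<alpha> (\<beta> \<union> \<gamma>) * gsign \<beta> \<gamma>"
  using assms
  by (simp add: gsign_def inversions_Un_left inversions_Un_right power_add[symmetric] ac_simps)

definition gprod :: "(nat set \<Rightarrow> complex) \<Rightarrow> (nat set \<Rightarrow> complex) \<Rightarrow> nat set \<Rightarrow> complex" where
  "gprod x y \<gamma> = (if finite \<gamma> then \<Sum>\<alpha>\<in>Pow \<gamma>. gsign \<alpha> (\<gamma> - \<alpha>) * x \<alpha> * y (\<gamma> - \<alpha>) else 0)"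

lemma gprod_summable:
  assumes x: "x abs_summable_on UNIV" and y: "y abs_summable_on UNIV"
  shows "gprod x y abs_summable_on UNIV"
    and "(\<Sum>\<^sub>\<infinity>\<gamma>. norm (gprod x y \<gamma>)) \<le> (\<Sum>\<^sub>\<infinity>\<alpha>. norm (x \<alpha>)) * (\<Sum>\<^sub>\<infinity>\<beta>. norm (y \<beta>))"
proof -
  let ?S = "Sigma (Collect finite) Pow :: (nat set \<times> nat set) set"
  let ?h = "\<lambda>(\<gamma>, \<alpha>). (\<alpha>, \<gamma> - \<alpha>) :: nat set \<times> nat set"
  let ?f = "\<lambda>(\<alpha>, \<beta>). norm (x \<alpha>) * norm (y \<beta>)"
  let ?g = "\<lambda>\<gamma> \<alpha>. norm (x \<alpha>) * norm (y (\<gamma> - \<alpha>))"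
  have inj: "inj_on ?h ?S"
    by (auto simp: inj_on_def)
  have "(\<lambda>(\<alpha>, \<beta>). x \<alpha> * y \<beta>) abs_summable_on Sigma UNIV (\<lambda>_. UNIV)"
    using x y by (subst abs_summable_on_Sigma_iff)
      (auto simp: norm_mult infsum_cmult_right' abs_mult infsum_nonneg
        intro!: summable_on_cmult_right summable_on_cmult_left)
  then have f: "?f summable_on UNIV \<times> UNIV"
    by (simp add: case_prod_unfold norm_mult)
  then have fh: "?f summable_on (?h ` ?S)"
    by (rule summable_on_subset_banach) simp
  then have gS: "(\<lambda>(\<gamma>, \<alpha>). ?g \<gamma> \<alpha>) summable_on ?S"
    using summable_on_reindex[OF inj, of ?f] by (simp add: o_def case_prod_unfold)
  have ginf: "(\<lambda>\<gamma>. infsum (?g \<gamma>) (Pow \<gamma>)) summable_on Collect finite"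
    by (rule summable_on_Sigma_banach[OF gS])
  have le: "norm (gprod x y \<gamma>) \<le> infsum (?g \<gamma>) (Pow \<gamma>)" if "finite \<gamma>" for \<gamma>
    using that by (simp add: gprod_def) (rule order_trans[OF norm_sum], simp add: norm_mult)
  have fin: "gprod x y abs_summable_on Collect finite"
    by (rule abs_summable_on_comparison_test'[OF ginf]) (use le in auto)
  then show s: "gprod x y abs_summable_on UNIV"
    by (subst summable_on_cong_neutral[where T = "Collect finite" and g = "\<lambda>\<gamma>. norm (gprod x y \<gamma>)"])
      (auto simp: gprod_def)
  have "(\<Sum>\<^sub>\<infinity>\<gamma>. norm (gprod x y \<gamma>)) = infsum (\<lambda>\<gamma>. norm (gprod x y \<gamma>)) (Collect finite)"
    by (rule infsum_cong_neutral) (auto simp: gprod_def)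
  also have "\<dots> \<le> infsum (\<lambda>\<gamma>. infsum (?g \<gamma>) (Pow \<gamma>)) (Collect finite)"
    by (rule infsum_mono[OF fin ginf]) (use le in auto)
  also have "\<dots> = infsum (\<lambda>(\<gamma>, \<alpha>). ?g \<gamma> \<alpha>) ?S"
    by (rule infsum_Sigma'_banach[OF gS])
  also have "\<dots> = infsum ?f (?h ` ?S)"
    using infsum_reindex[OF inj, of ?f] by (simp add: o_def case_prod_unfold)
  also have "\<dots> \<le> infsum ?f (UNIV \<times> UNIV)"
    by (rule infsum_mono_neutral[OF fh f]) auto
  also have "\<dots> = (\<Sum>\<^sub>\<infinity>\<alpha>. \<Sum>\<^sub>\<infinity>\<beta>. norm (x \<alpha>) * norm (y \<beta>))"
    using infsum_Sigma'_banach[OF f] by simp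
  also have "\<dots> = (\<Sum>\<^sub>\<infinity>\<alpha>. norm (x \<alpha>)) * (\<Sum>\<^sub>\<infinity>\<beta>. norm (y \<beta>))"
    by (simp add: infsum_cmult_right' infsum_cmult_left')
  finally show "(\<Sum>\<^sub>\<infinity>\<gamma>. norm (gprod x y \<gamma>)) \<le> (\<Sum>\<^sub>\<infinity>\<alpha>. norm (x \<alpha>)) * (\<Sum>\<^sub>\<infinity>\<beta>. norm (y \<beta>))" .
qed

lemma gprod_assoc: "gprod (gprod x y) z = gprod x (gprod y z)"
proof
  fix \<gamma>
  show "gprod (gprod x y) z \<gamma> = gprod x (gprod y z) \<gamma>"
  proof (cases "finite \<gamma>")
    case fin: True
    have fs: "finite \<alpha>" if "\<alpha> \<subseteq> \<gamma>" for \<alpha>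
      using that fin finite_subset by auto
    have "gprod (gprod x y) z \<gamma> = (\<Sum>\<delta>\<in>Pow \<gamma>. \<Sum>\<alpha>\<in>Pow \<delta>.
        gsign \<delta> (\<gamma> - \<delta>) * gsign \<alpha> (\<delta> - \<alpha>) * x \<alpha> * y (\<delta> - \<alpha>) * z (\<gamma> - \<delta>))"
      by (simp add: gprod_def fin fs sum_distrib_left sum_distrib_right mult.assoc)
    also have "\<dots> = (\<Sum>(\<delta>, \<alpha>)\<in>Sigma (Pow \<gamma>) Pow.
        gsign \<delta> (\<gamma> - \<delta>) * gsign \<alpha> (\<delta> - \<alpha>) * x \<alpha> * y (\<delta> - \<alpha>) * z (\<gamma> - \<delta>))"
      by (rule sum.Sigma) (use fin fs in auto)
    also have "\<dots> = (\<Sum>(\<alpha>, \<beta>)\<in>Sigma (Pow \<gamma>) (\<lambda>\<alpha>. Pow (\<gamma> - \<alpha>)).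
        gsign \<alpha> (\<gamma> - \<alpha>) * gsign \<beta> (\<gamma> - \<alpha> - \<beta>) * x \<alpha> * y \<beta> * z (\<gamma> - \<alpha> - \<beta>))"
    proof (rule sum.reindex_bij_witness[where i = "\<lambda>(\<alpha>, \<beta>). (\<alpha> \<union> \<beta>, \<alpha>)"
          and j = "\<lambda>(\<delta>, \<alpha>). (\<alpha>, \<delta> - \<alpha>)"], goal_cases)
      case (5 p)
      obtain \<delta> \<alpha> where p: "p = (\<delta>, \<alpha>)" and sub: "\<delta> \<subseteq> \<gamma>" "\<alpha> \<subseteq> \<delta>"
        using 5 by auto
      have "gsign \<alpha> (\<delta> - \<alpha>) * gsign (\<alpha> \<union> (\<delta> - \<alpha>)) (\<gamma> - \<delta>) =
          gsign \<alpha> ((\<delta> - \<alpha>) \<union> (\<gamma> - \<delta>)) * gsign (\<delta> - \<alpha>) (\<gamma> - \<delta>)"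
        by (rule gsign_cocycle) (use sub fs fin in auto)
      moreover have "\<alpha> \<union> (\<delta> - \<alpha>) = \<delta>" "(\<delta> - \<alpha>) \<union> (\<gamma> - \<delta>) = \<gamma> - \<alpha>" "\<gamma> - \<alpha> - (\<delta> - \<alpha>) = \<gamma> - \<delta>"
        using sub by auto
      ultimately show ?case
        by (simp add: p mult.commute)
    qed auto
    also have "\<dots> = (\<Sum>\<alpha>\<in>Pow \<gamma>. \<Sum>\<beta>\<in>Pow (\<gamma> - \<alpha>).
        gsign \<alpha> (\<gamma> - \<alpha>) * gsign \<beta> (\<gamma> - \<alpha> - \<beta>) * x \<alpha> * y \<beta> * z (\<gamma> - \<alpha> - \<beta>))"
      by (rule sum.Sigma[symmetric]) (use fin fs in auto)
    also have "\<dots> = gprod x (gprod y z) \<gamma>"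
      by (simp add: gprod_def fin sum_distrib_left mult_ac)
    finally show ?thesis .
  qed (simp add: gprod_def)
qed

lemma gprod_one_left:
  assumes "\<forall>\<alpha>. infinite \<alpha> \<longrightarrow> x \<alpha> = 0"
  shows "gprod (\<lambda>\<alpha>. if \<alpha> = {} then 1 else 0) x = x"
proof
  fix \<gamma> show "gprod (\<lambda>\<alpha>. if \<alpha> = {} then 1 else 0) x \<gamma> = x \<gamma>"
  proof (cases "finite \<gamma>")
    case True
    have "gprod (\<lambda>\<alpha>. if \<alpha> = {} then 1 else 0) x \<gamma> = (\<Sum>\<alpha>\<in>Pow \<gamma>. if \<alpha> = {} then x \<gamma> else 0)"
      unfolding gprod_def if_P[OF True] by (rule sum.cong) auto
    then show ?thesis using True by (simp add: sum.delta)
  qed (use assms in \<open>simp add: gprod_def\<close>)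
qed

lemma gprod_one_right:
  assumes "\<forall>\<alpha>. infinite \<alpha> \<longrightarrow> x \<alpha> = 0"
  shows "gprod x (\<lambda>\<alpha>. if \<alpha> = {} then 1 else 0) = x"
proof
  fix \<gamma> show "gprod x (\<lambda>\<alpha>. if \<alpha> = {} then 1 else 0) \<gamma> = x \<gamma>"
  proof (cases "finite \<gamma>")
    case True
    have "gprod x (\<lambda>\<alpha>. if \<alpha> = {} then 1 else 0) \<gamma> = (\<Sum>\<alpha>\<in>Pow \<gamma>. if \<alpha> = \<gamma> then x \<gamma> else 0)"
      unfolding gprod_def if_P[OF True] by (rule sum.cong) auto
    then show ?thesis using True by (simp add: sum.delta)
  qed (use assms in \<open>simp add: gprod_def\<close>)
qed

lemma gunit_summable [simp]: "(\<lambda>\<alpha>. if \<alpha> = \<beta> then 1 else 0 :: complex) abs_summable_on UNIV"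
  by (subst summable_on_cong_neutral[where T = "{\<beta>}" and g = "\<lambda>_. 1"]) auto

lemma abs_summable_add:
  fixes x y :: "'a \<Rightarrow> complex"
  assumes "x abs_summable_on A" "y abs_summable_on A"
  shows "(\<lambda>\<alpha>. x \<alpha> + y \<alpha>) abs_summable_on A"
  by (rule abs_summable_on_comparison_test'[OF summable_on_add[OF assms]]) (rule norm_triangle_ineq)

lemma abs_summable_diff:
  fixes x y :: "'a \<Rightarrow> complex"
  assumes "x abs_summable_on A" "y abs_summable_on A"
  shows "(\<lambda>\<alpha>. x \<alpha> - y \<alpha>) abs_summable_on A"
  by (rule abs_summable_on_comparison_test'[OF summable_on_add[OF assms]]) (rule norm_triangle_ineq4)

instantiation grassmann :: ring_1
begin

lift_definition zero_grassmann :: grassmann is "\<lambda>_. 0" by simp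

lift_definition one_grassmann :: grassmann is "\<lambda>\<alpha>. if \<alpha> = {} then 1 else 0" by auto

lift_definition plus_grassmann :: "grassmann \<Rightarrow> grassmann \<Rightarrow> grassmann" is "\<lambda>x y \<alpha>. x \<alpha> + y \<alpha>"
  by (simp add: abs_summable_add)

lift_definition minus_grassmann :: "grassmann \<Rightarrow> grassmann \<Rightarrow> grassmann" is "\<lambda>x y \<alpha>. x \<alpha> - y \<alpha>"
  by (simp add: abs_summable_diff)

lift_definition uminus_grassmann :: "grassmann \<Rightarrow> grassmann" is "\<lambda>x \<alpha>. - x \<alpha>"
  by auto

lift_definition times_grassmann :: "grassmann \<Rightarrow> grassmann \<Rightarrow> grassmann" is gprod
  by (auto simp: gprod_summable) (simp add: gprod_def)

instance
proof
  fix a b c :: grassmann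
  show "a + b + c = a + (b + c)" by transfer (simp add: add.assoc)
  show "a + b = b + a" by transfer (simp add: add.commute)
  show "0 + a = a" by transfer simp
  show "- a + a = 0" by transfer simp
  show "a - b = a + - b" by transfer simp
  show "a * b * c = a * (b * c)" by transfer (rule gprod_assoc)
  show "(a + b) * c = a * c + b * c"
    by transfer (auto simp: gprod_def algebra_simps sum.distrib)
  show "a * (b + c) = a * b + a * c"
    by transfer (auto simp: gprod_def algebra_simps sum.distrib)
  show "1 * a = a" by transfer (simp add: gprod_one_left)
  show "a * 1 = a" by transfer (simp add: gprod_one_right)
  show "(0 :: grassmann) \<noteq> 1" by transfer (auto simp: fun_eq_iff)
qed

end

instantiation grassmann :: real_normed_algebra_1
begin

lift_definition scaleR_grassmann :: "real \<Rightarrow> grassmann \<Rightarrow> grassmann" is "\<lambda>r x \<alpha>. r *\<^sub>R x \<alpha>"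
  by (auto intro: summable_on_cmult_right)

lift_definition norm_grassmann :: "grassmann \<Rightarrow> real" is "\<lambda>x. \<Sum>\<^sub>\<infinity>\<alpha>. norm (x \<alpha>)" .

definition dist_grassmann :: "grassmann \<Rightarrow> grassmann \<Rightarrow> real" where
  "dist_grassmann x y = norm (x - y)"

definition sgn_grassmann :: "grassmann \<Rightarrow> grassmann" where
  "sgn_grassmann x = inverse (norm x) *\<^sub>R x"

definition uniformity_grassmann :: "(grassmann \<times> grassmann) filter" where
  "uniformity_grassmann = (INF e\<in>{0<..}. principal {(x, y). dist x y < e})"

definition open_grassmann :: "grassmann set \<Rightarrow> bool" where
  "open_grassmann U \<longleftrightarrow> (\<forall>x\<in>U. eventually (\<lambda>(x', y). x' = x \<longrightarrow> y \<in> U) uniformity)"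

instance
proof
  fix a b :: real and x y :: grassmann and U :: "grassmann set"
  show "dist x y = norm (x - y)" by (rule dist_grassmann_def)
  show "sgn x = inverse (norm x) *\<^sub>R x" by (rule sgn_grassmann_def)
  show "uniformity = (INF e\<in>{0<..}. principal {(x :: grassmann, y). dist x y < e})"
    by (rule uniformity_grassmann_def)
  show "open U \<longleftrightarrow> (\<forall>x\<in>U. \<forall>\<^sub>F (x', y) in uniformity. x' = x \<longrightarrow> y \<in> U)"
    by (rule open_grassmann_def)
  show "a *\<^sub>R (x + y) = a *\<^sub>R x + a *\<^sub>R y" by transfer (simp add: algebra_simps)
  show "(a + b) *\<^sub>R x = a *\<^sub>R x + b *\<^sub>R x" by transfer (simp add: algebra_simps)
  show "a *\<^sub>R b *\<^sub>R x = (a * b) *\<^sub>R x" by transfer simp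
  show "1 *\<^sub>R x = x" by transfer simp
  show "a *\<^sub>R x * y = a *\<^sub>R (x * y)"
    by transfer (auto simp: gprod_def scaleR_sum_right fun_eq_iff intro!: sum.cong)
  show "x * a *\<^sub>R y = a *\<^sub>R (x * y)"
    by transfer (auto simp: gprod_def scaleR_sum_right fun_eq_iff intro!: sum.cong)
  show "norm x = 0 \<longleftrightarrow> x = 0"
  proof (transfer, safe, goal_cases)
    case (1 x)
    then have "norm (x \<alpha>) = 0" for \<alpha>
      by (intro nonneg_infsum_le_0D[of "\<lambda>\<alpha>. norm (x \<alpha>)" UNIV \<alpha>]) auto
    then show ?case by auto
  qed simp
  show "norm (x + y) \<le> norm x + norm y"
  proof (transfer, safe, goal_cases)
    case (1 x y)
    have "(\<Sum>\<^sub>\<infinity>\<alpha>. norm (x \<alpha> + y \<alpha>)) \<le> (\<Sum>\<^sub>\<infinity>\<alpha>. norm (x \<alpha>) + norm (y \<alpha>))"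
      by (rule infsum_mono)
        (use 1 in \<open>auto intro!: summable_on_add norm_triangle_ineq abs_summable_add\<close>)
    also have "\<dots> = (\<Sum>\<^sub>\<infinity>\<alpha>. norm (x \<alpha>)) + (\<Sum>\<^sub>\<infinity>\<alpha>. norm (y \<alpha>))"
      by (rule infsum_add) (use 1 in auto)
    finally show ?case .
  qed
  show "norm (a *\<^sub>R x) = \<bar>a\<bar> * norm x"
    by transfer (simp add: infsum_cmult_right')
  show "norm (x * y) \<le> norm x * norm y"
    by transfer (simp add: gprod_summable)
  show "norm (1 :: grassmann) = 1"
  proof transfer
    have "(\<Sum>\<^sub>\<infinity>\<alpha> :: nat set. norm (if \<alpha> = {} then 1 else 0 :: complex)) =
        infsum (\<lambda>\<alpha>. norm (if \<alpha> = {} then 1 else 0 :: complex)) {{} :: nat set}"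
      by (rule infsum_cong_neutral) auto
    then show "(\<Sum>\<^sub>\<infinity>\<alpha> :: nat set. norm (if \<alpha> = {} then 1 else 0 :: complex)) = 1" by simp
  qed
qed

end

lemma norm_gcoeff_sum_le:
  assumes "finite T"
  shows "(\<Sum>\<alpha>\<in>T. norm (gcoeff x \<alpha>)) \<le> norm x"
  unfolding norm_grassmann.rep_eq
  by (rule finite_sum_le_infsum) (use gcoeff[of x] assms in auto)

instance grassmann :: banach
proof
  fix X :: "nat \<Rightarrow> grassmann"
  assume X: "Cauchy X"
  have coeff_le: "norm (gcoeff x \<alpha>) \<le> norm x" for x \<alpha>
    using norm_gcoeff_sum_le[of "{\<alpha>}" x] by simp
  have "convergent (\<lambda>n. gcoeff (X n) \<alpha>)" for \<alpha>
  proof (rule Cauchy_convergent, rule CauchyI)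
    fix e :: real assume "0 < e"
    with CauchyD[OF X] obtain M where M: "norm (X m - X n) < e" if "m \<ge> M" "n \<ge> M" for m n
      by blast
    have "norm (gcoeff (X m) \<alpha> - gcoeff (X n) \<alpha>) < e" if "m \<ge> M" "n \<ge> M" for m n
      using M[OF that] coeff_le[of "X m - X n" \<alpha>] by (simp add: minus_grassmann.rep_eq)
    then show "\<exists>M. \<forall>m\<ge>M. \<forall>n\<ge>M. norm (gcoeff (X m) \<alpha> - gcoeff (X n) \<alpha>) < e" by blast
  qed
  then obtain l where l: "(\<lambda>n. gcoeff (X n) \<alpha>) \<longlonglongrightarrow> l \<alpha>" for \<alpha>
    unfolding convergent_def by metis
  have bound: "(\<Sum>\<alpha>\<in>T. norm (gcoeff (X n) \<alpha> - l \<alpha>)) \<le> e"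
    if "finite T" and M: "\<And>m. m \<ge> M \<Longrightarrow> norm (X n - X m) \<le> e" for T n M e
  proof (rule LIMSEQ_le_const2)
    show "(\<lambda>m. \<Sum>\<alpha>\<in>T. norm (gcoeff (X n) \<alpha> - gcoeff (X m) \<alpha>)) \<longlonglongrightarrow>
        (\<Sum>\<alpha>\<in>T. norm (gcoeff (X n) \<alpha> - l \<alpha>))"
      by (intro tendsto_intros l)
    show "\<exists>M. \<forall>m\<ge>M. (\<Sum>\<alpha>\<in>T. norm (gcoeff (X n) \<alpha> - gcoeff (X m) \<alpha>)) \<le> e"
      using norm_gcoeff_sum_le[OF \<open>finite T\<close>, of "X n - X m" for m] M
      by (intro exI[of _ M]) (force simp: minus_grassmann.rep_eq intro: order_trans)
  qed
  have summ: "(\<lambda>\<alpha>. gcoeff (X n) \<alpha> - l \<alpha>) abs_summable_on UNIV"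
    if "\<And>m. m \<ge> M \<Longrightarrow> norm (X n - X m) \<le> e" for n M e
    unfolding abs_summable_iff_bdd_above
    by (rule bdd_aboveI2) (use bound[OF _ that] in auto)
  obtain M1 where M1: "norm (X m - X n) < 1" if "m \<ge> M1" "n \<ge> M1" for m n
    using CauchyD[OF X, of 1] by auto
  have "(\<lambda>\<alpha>. gcoeff (X M1) \<alpha> - l \<alpha>) abs_summable_on UNIV"
    by (rule summ[of M1 M1 1]) (use M1 in \<open>auto intro: less_imp_le\<close>)
  from abs_summable_diff[OF _ this, of "gcoeff (X M1)"] gcoeff[of "X M1"]
  have l_sum: "l abs_summable_on UNIV" by simp
  have l_inf: "l \<alpha> = 0" if "infinite \<alpha>" for \<alpha>
    using l[of \<alpha>] gcoeff[of "X n" for n] that by (simp add: LIMSEQ_const_iff)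
  define L where "L = Abs_grassmann l"
  have L: "gcoeff L = l"
    unfolding L_def by (rule Abs_grassmann_inverse) (use l_sum l_inf in auto)
  have "X \<longlonglongrightarrow> L"
  proof (rule LIMSEQ_I)
    fix e :: real assume "0 < e"
    then obtain M where M: "norm (X m - X n) < e / 2" if "m \<ge> M" "n \<ge> M" for m n
      using CauchyD[OF X, of "e / 2"] by (metis half_gt_zero)
    have "norm (X n - L) \<le> e / 2" if n: "n \<ge> M" for n
    proof -
      have *: "norm (X n - X m) \<le> e / 2" if "m \<ge> M" for m
        using M[OF n that] by simp
      show ?thesis
        unfolding norm_grassmann.rep_eq minus_grassmann.rep_eq L
        by (rule infsum_le_finite_sums[OF summ[OF *]]) (use bound[OF _ *] in auto)
    qed
    then show "\<exists>no. \<forall>n\<ge>no. norm (X n - L) < e"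
      using \<open>0 < e\<close> by (intro exI[of _ M]) (force intro: le_less_trans)
  qed
  then show "convergent X" by (rule convergentI)
qed

text \<open>The basis elements \<open>i\<^sub>\<alpha>\<close>; the generators are \<open>gbasis {n}\<close>.\<close>

lift_definition gbasis :: "nat set \<Rightarrow> grassmann" is "\<lambda>\<alpha> \<beta>. if finite \<alpha> \<and> \<beta> = \<alpha> then 1 else 0"
proof (safe, goal_cases)
  case (2 \<alpha>)
  then show ?case by (cases "finite \<alpha>") auto
qed auto

lemma gbasis_empty: "gbasis {} = 1"
  by transfer auto

lemma gbasis_mult:
  assumes "finite \<alpha>" "finite \<beta>"
  shows "gcoeff (gbasis \<alpha> * gbasis \<beta>) \<gamma> =
    (if \<alpha> \<inter> \<beta> = {} \<and> \<gamma> = \<alpha> \<union> \<beta> then gsign \<alpha> \<beta> else 0)"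
proof (cases "finite \<gamma>")
  case True
  have "gcoeff (gbasis \<alpha> * gbasis \<beta>) \<gamma> =
      (\<Sum>\<delta>\<in>Pow \<gamma>. if \<delta> = \<alpha> then (if \<gamma> - \<alpha> = \<beta> then gsign \<alpha> \<beta> else 0) else 0)"
    unfolding times_grassmann.rep_eq gprod_def if_P[OF True]
    by (rule sum.cong) (use assms in \<open>auto simp: gbasis.rep_eq\<close>)
  also have "\<dots> = (if \<alpha> \<subseteq> \<gamma> \<and> \<gamma> - \<alpha> = \<beta> then gsign \<alpha> \<beta> else 0)"
    using True by (simp add: sum.delta)
  also have "\<dots> = (if \<alpha> \<inter> \<beta> = {} \<and> \<gamma> = \<alpha> \<union> \<beta> then gsign \<alpha> \<beta> else 0)"
    by (rule if_cong) auto
  finally show ?thesis .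
qed (use assms in \<open>auto simp: times_grassmann.rep_eq gprod_def\<close>)

lemma gbasis_insert:
  assumes "finite \<alpha>" "\<forall>a\<in>\<alpha>. a < n"
  shows "gbasis \<alpha> * gbasis {n} = gbasis (insert n \<alpha>)"
proof -
  have "{(a, b). a \<in> \<alpha> \<and> b \<in> {n} \<and> b < a} = {}"
    using assms(2) by force
  then have "gsign \<alpha> {n} = 1"
    by (simp only: gsign_def inversions_def card.empty power_0)
  moreover have "n \<notin> \<alpha>"
    using assms(2) by blast
  ultimately show ?thesis
    using assms by (auto simp: gcoeff_inject[symmetric] fun_eq_iff gbasis_mult gbasis.rep_eq)
qed

lemma generators_anticommute: "gbasis {n} * gbasis {m} + gbasis {m} * gbasis {n} = 0"
proof -
  have *: "gsign {n} {m} = (if m < n then -1 else 1)" for n m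
  proof -
    have "{(a, b). a \<in> {n} \<and> b \<in> {m} \<and> b < a} = (if m < n then {(n, m)} else {})" by auto
    then show ?thesis by (simp add: gsign_def inversions_def)
  qed
  show ?thesis
    by (auto simp: gcoeff_inject[symmetric] fun_eq_iff gbasis_mult plus_grassmann.rep_eq
        zero_grassmann.rep_eq *)
qed


section \<open>Matrix power series\<close>

text \<open>A power series \<open>\<Sum> z\<^sup>n f\<^sub>n\<close> with matrix coefficients is represented by the matrix of its
  entries, each of which is a formal power series over the (noncommutative) ring of scalars.
  The product of formal power series is the Cauchy product that keeps coefficients in order,
  so the star product is the matrix product \<open>(*)\<close> (see \<open>coeff_mat_star\<close> below), \<open>fps_X\<close> is
  the variable \<open>z\<close>, and \<open>fps_const\<close> embeds the constants.\<close>

definition coeff_mat :: "'a :: zero fps mat \<Rightarrow> nat \<Rightarrow> 'a mat" where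
  "coeff_mat F n = map_mat (\<lambda>f. fps_nth f n) F"

abbreviation const_mat :: "'a :: zero mat \<Rightarrow> 'a fps mat" where
  "const_mat \<equiv> map_mat fps_const"

lemma coeff_mat_star:
  fixes F G :: "'a :: ring_1 fps mat"
  assumes "F \<in> carrier_mat p m" "G \<in> carrier_mat m q" "i < p" "j < q"
  shows "coeff_mat (F * G) n $$ (i, j) = (\<Sum>u=0..n. (coeff_mat F u * coeff_mat G (n - u)) $$ (i, j))"
proof -
  have "coeff_mat (F * G) n $$ (i, j) =
      (\<Sum>k<m. \<Sum>u=0..n. fps_nth (F $$ (i, k)) u * fps_nth (G $$ (k, j)) (n - u))"
    using assms by (simp add: coeff_mat_def scalar_prod_def fps_sum_nth fps_mult_nth atLeast0LessThan)
  also have "\<dots> = (\<Sum>u=0..n. \<Sum>k<m. fps_nth (F $$ (i, k)) u * fps_nth (G $$ (k, j)) (n - u))"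
    by (rule sum.swap)
  also have "\<dots> = (\<Sum>u=0..n. (coeff_mat F u * coeff_mat G (n - u)) $$ (i, j))"
    using assms by (intro sum.cong) (simp_all add: coeff_mat_def scalar_prod_def atLeast0LessThan)
  finally show ?thesis .
qed

definition Gamma :: "nat \<Rightarrow> nat \<Rightarrow> grassmann fps mat set" where
  "Gamma p q = {F \<in> carrier_mat p q.
     \<exists>r>0. \<forall>z. norm z < r \<longrightarrow> (\<forall>i<p. \<forall>j<q. summable (\<lambda>n. z ^ n * coeff_mat F n $$ (i, j)))}"

definition poly_mat :: "'a :: zero fps mat \<Rightarrow> bool" where
  "poly_mat F \<longleftrightarrow> (\<exists>k. \<forall>n>k. coeff_mat F n = 0\<^sub>m (dim_row F) (dim_col F))"

text \<open>Inverses for the star product, of scalar series and of square matrix series. They are only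
  used when the constant coefficient is invertible; see the lemmas of the same names for
  existence and uniqueness in this case.\<close>

definition star_inv :: "'a :: ring_1 fps \<Rightarrow> 'a fps" where
  "star_inv f = (THE g. f * g = 1 \<and> g * f = 1)"

definition star_inv_mat :: "'a :: ring_1 fps mat \<Rightarrow> 'a fps mat" where
  "star_inv_mat F = (THE G. inverts_mat F G \<and> inverts_mat G F)"

lemma star_inv:
  assumes "fps_nth f 0 * b = 1" "b * fps_nth f 0 = 1"
  shows "f * star_inv f = 1" "star_inv f * f = 1"
proof -
  let ?l = "fps_left_inverse f b" and ?r = "fps_right_inverse f b"
  have l: "?l * f = 1" and r: "f * ?r = 1"
    using assms by (auto intro: fps_left_inverse fps_right_inverse)
  have "?l = ?l * (f * ?r)" by (simp add: r)
  also have "\<dots> = ?r" by (simp add: mult.assoc[symmetric] l)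
  finally have "f * ?r = 1 \<and> ?r * f = 1" using l r by simp
  moreover have "g = ?r" if "f * g = 1 \<and> g * f = 1" for g
  proof -
    have "g = g * (f * ?r)" by (simp add: r)
    also have "\<dots> = ?r" using that by (simp add: mult.assoc[symmetric])
    finally show ?thesis .
  qed
  ultimately have "f * star_inv f = 1 \<and> star_inv f * f = 1"
    unfolding star_inv_def by (rule theI)
  then show "f * star_inv f = 1" "star_inv f * f = 1" by auto
qed

fun rinv_coeff ::
  "nat \<Rightarrow> (nat \<Rightarrow> nat \<Rightarrow> nat \<Rightarrow> 'a :: ring_1) \<Rightarrow> (nat \<Rightarrow> nat \<Rightarrow> 'a) \<Rightarrow> nat \<Rightarrow> nat \<Rightarrow> nat \<Rightarrow> 'a" where
  "rinv_coeff N f b n i j = (if n = 0 then b i j else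
     - (\<Sum>k<N. b i k * (\<Sum>u\<in>{1..n}. \<Sum>l<N. f u k l * rinv_coeff N f b (n - u) l j)))"

declare rinv_coeff.simps [simp del]

lemma star_right_inverse_mat:
  fixes F :: "'a :: ring_1 fps mat"
  assumes F: "F \<in> carrier_mat N N" and B: "B \<in> carrier_mat N N"
    and FB: "coeff_mat F 0 * B = 1\<^sub>m N"
  shows "\<exists>G\<in>carrier_mat N N. F * G = 1\<^sub>m N \<and> coeff_mat G 0 = B"
proof -
  define f where "f n i j = fps_nth (F $$ (i, j)) n" for n i j
  define b where "b i j = B $$ (i, j)" for i j
  define g where "g = rinv_coeff N f b"
  define G where "G = mat N N (\<lambda>(i, j). Abs_fps (\<lambda>n. g n i j))"
  have fb: "(\<Sum>l<N. f 0 i l * b l j) = (if i = j then 1 else 0)" if "i < N" "j < N" for i j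
    using arg_cong[OF FB, of "\<lambda>M. M $$ (i, j)"] F B that
    by (simp add: coeff_mat_def scalar_prod_def f_def b_def atLeast0LessThan)
  have conv: "(\<Sum>u=0..n. \<Sum>l<N. f u i l * g (n - u) l j) = (if n = 0 \<and> i = j then 1 else 0)"
    if ij: "i < N" "j < N" for n i j
  proof (cases "n = 0")
    case True
    then show ?thesis using fb[OF ij] by (simp add: g_def rinv_coeff.simps[of _ _ _ 0])
  next
    case False
    define r where "r k = (\<Sum>u\<in>{1..n}. \<Sum>l<N. f u k l * g (n - u) l j)" for k
    have gn: "g n l j = - (\<Sum>k<N. b l k * r k)" for l
      using False unfolding g_def r_def by (subst rinv_coeff.simps) simp
    have "(\<Sum>l<N. f 0 i l * g n l j) = - (\<Sum>l<N. \<Sum>k<N. f 0 i l * b l k * r k)"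
      by (simp add: gn sum_distrib_left sum_negf mult.assoc)
    also have "\<dots> = - (\<Sum>k<N. \<Sum>l<N. f 0 i l * b l k * r k)"
      by (subst sum.swap) simp
    also have "\<dots> = - (\<Sum>k<N. (if i = k then 1 else 0) * r k)"
      by (simp only: sum_distrib_right[symmetric])
        (intro arg_cong[of _ _ uminus] sum.cong, simp_all add: fb ij(1))
    also have "\<dots> = - (\<Sum>k<N. if k = i then r k else 0)"
      by (intro arg_cong[of _ _ uminus] sum.cong) auto
    also have "\<dots> = - r i"
      using ij(1) by (simp add: sum.delta)
    finally have "(\<Sum>l<N. f 0 i l * g n l j) + r i = 0" by simp
    moreover have "(\<Sum>u=0..n. \<Sum>l<N. f u i l * g (n - u) l j) =
        (\<Sum>l<N. f 0 i l * g n l j) + r i"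
      unfolding r_def by (subst sum.atLeast_Suc_atMost) auto
    ultimately show ?thesis using False by simp
  qed
  have G: "G \<in> carrier_mat N N" by (simp add: G_def)
  have "F * G = 1\<^sub>m N"
  proof (rule eq_matI)
    fix i j assume "i < dim_row (1\<^sub>m N :: 'a fps mat)" "j < dim_col (1\<^sub>m N :: 'a fps mat)"
    then have ij: "i < N" "j < N" by auto
    show "(F * G) $$ (i, j) = 1\<^sub>m N $$ (i, j)"
    proof (rule fps_ext)
      fix n
      have "fps_nth ((F * G) $$ (i, j)) n = (\<Sum>l<N. \<Sum>u=0..n. f u i l * g (n - u) l j)"
        using ij F by (simp add: scalar_prod_def G_def f_def fps_sum_nth fps_mult_nth atLeast0LessThan)
      also have "\<dots> = (\<Sum>u=0..n. \<Sum>l<N. f u i l * g (n - u) l j)"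
        by (rule sum.swap)
      finally show "fps_nth ((F * G) $$ (i, j)) n = fps_nth (1\<^sub>m N $$ (i, j)) n"
        using conv[OF ij, of n] ij by (auto simp: fps_one_nth)
    qed
  qed (use F G in auto)
  moreover have "coeff_mat G 0 = B"
    by (rule eq_matI) (use B in \<open>auto simp: coeff_mat_def G_def g_def b_def rinv_coeff.simps[of _ _ _ 0]\<close>)
  ultimately show ?thesis using G by blast
qed

lemma star_inv_mat:
  fixes F :: "'a :: ring_1 fps mat"
  assumes F: "F \<in> carrier_mat N N" and inv: "invertible_mat (coeff_mat F 0)"
  shows "star_inv_mat F \<in> carrier_mat N N"
    and "F * star_inv_mat F = 1\<^sub>m N" and "star_inv_mat F * F = 1\<^sub>m N"
proof -
  have F0: "coeff_mat F 0 \<in> carrier_mat N N"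
    using F by (simp add: coeff_mat_def)
  obtain B where FB: "coeff_mat F 0 * B = 1\<^sub>m N" and BF: "B * coeff_mat F 0 = 1\<^sub>m (dim_row B)"
    using inv F0 unfolding invertible_mat_def inverts_mat_def by auto
  have B: "B \<in> carrier_mat N N"
    using arg_cong[OF FB, of dim_col] arg_cong[OF BF, of dim_col] F0 by auto
  obtain G where G: "G \<in> carrier_mat N N" and FG: "F * G = 1\<^sub>m N" and G0: "coeff_mat G 0 = B"
    using star_right_inverse_mat[OF F B FB] by blast
  have "coeff_mat G 0 * coeff_mat F 0 = 1\<^sub>m N"
    using BF B G0 by simp
  then obtain H where H: "H \<in> carrier_mat N N" and GH: "G * H = 1\<^sub>m N"
    using star_right_inverse_mat[OF G F0] by blast
  have "F = F * (G * H)" using F GH by simp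
  also have "\<dots> = H" using F G H FG by (simp add: assoc_mult_mat[symmetric])
  finally have GF: "G * F = 1\<^sub>m N" using GH by simp
  have "inverts_mat F G \<and> inverts_mat G F"
    using F G FG GF by (simp add: inverts_mat_def)
  moreover have "K = G" if K: "inverts_mat F K \<and> inverts_mat K F" for K
  proof -
    have FK: "F * K = 1\<^sub>m N" and KF: "K * F = 1\<^sub>m (dim_row K)"
      using K F by (auto simp: inverts_mat_def)
    have Kc: "K \<in> carrier_mat N N"
      using arg_cong[OF FK, of dim_col] arg_cong[OF KF, of dim_col] F by auto
    have "K = (G * F) * K" using Kc GF by simp
    also have "\<dots> = G" using F G Kc FK by (simp add: assoc_mult_mat)
    finally show ?thesis .
  qed
  ultimately have "star_inv_mat F = G"
    unfolding star_inv_mat_def by (rule the_equality)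
  then show "star_inv_mat F \<in> carrier_mat N N"
    and "F * star_inv_mat F = 1\<^sub>m N" and "star_inv_mat F * F = 1\<^sub>m N"
    using G FG GF by auto
qed


section \<open>The conditions of the theorem\<close>

inductive_set star_rational :: "'a :: ring_1 fps set" where
  const: "fps_const c \<in> star_rational"
| var: "fps_X \<in> star_rational"
| add: "f \<in> star_rational \<Longrightarrow> g \<in> star_rational \<Longrightarrow> f + g \<in> star_rational"
| mult: "f \<in> star_rational \<Longrightarrow> g \<in> star_rational \<Longrightarrow> f * g \<in> star_rational"
| inv: "f \<in> star_rational \<Longrightarrow> \<exists>b. fps_nth f 0 * b = 1 \<and> b * fps_nth f 0 = 1 \<Longrightarrow>
    star_inv f \<in> star_rational"

definition entries_star_rational :: "nat \<Rightarrow> nat \<Rightarrow> grassmann fps mat \<Rightarrow> bool" where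
  "entries_star_rational p q F \<longleftrightarrow> (\<forall>i<p. \<forall>j<q. F $$ (i, j) \<in> star_rational)"

definition polynomial_fraction :: "nat \<Rightarrow> nat \<Rightarrow> grassmann fps mat \<Rightarrow> bool" where
  "polynomial_fraction p q F \<longleftrightarrow>
     (\<exists>m\<ge>1. \<exists>M1 \<in> Gamma p m. \<exists>M2 \<in> Gamma m m. \<exists>M3 \<in> Gamma m q.
        poly_mat M1 \<and> poly_mat M2 \<and> poly_mat M3 \<and> invertible_mat (coeff_mat M2 0) \<and>
        F = M1 * star_inv_mat M2 * M3)"

definition has_realization :: "nat \<Rightarrow> nat \<Rightarrow> grassmann fps mat \<Rightarrow> bool" where
  "has_realization p q F \<longleftrightarrow>
     (\<exists>N\<ge>1. \<exists>A \<in> carrier_mat N N. \<exists>B \<in> carrier_mat N q. \<exists>C \<in> carrier_mat p N. \<exists>D \<in> carrier_mat p q.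
        F = const_mat D +
          (fps_X \<cdot>\<^sub>m const_mat C) * star_inv_mat (1\<^sub>m N - fps_X \<cdot>\<^sub>m const_mat A) * const_mat B)"

definition has_coefficient_formula :: "nat \<Rightarrow> nat \<Rightarrow> grassmann fps mat \<Rightarrow> bool" where
  "has_coefficient_formula p q F \<longleftrightarrow>
     (\<exists>N\<ge>1. \<exists>A \<in> carrier_mat N N. \<exists>B \<in> carrier_mat N q. \<exists>C \<in> carrier_mat p N. \<exists>D \<in> carrier_mat p q.
        coeff_mat F 0 = D \<and> (\<forall>n\<ge>1. coeff_mat F n = C * A ^\<^sub>m (n - 1) * B))"

definition backward_shift :: "'a :: zero fps mat \<Rightarrow> 'a fps mat" where
  "backward_shift F = map_mat (fps_shift 1) F"

text \<open>Right action of the scalars on columns of series, and the right submodule spanned by a set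
  of columns of length \<open>p\<close>.\<close>

definition right_scale :: "'a :: ring_1 fps vec \<Rightarrow> 'a \<Rightarrow> 'a fps vec" where
  "right_scale v c = map_vec (\<lambda>f. f * fps_const c) v"

inductive_set right_span :: "nat \<Rightarrow> 'a :: ring_1 fps vec set \<Rightarrow> 'a fps vec set"
  for p :: nat and S :: "'a fps vec set" where
  zero: "0\<^sub>v p \<in> right_span p S"
| add: "w \<in> right_span p S \<Longrightarrow> v \<in> S \<Longrightarrow> w + right_scale v c \<in> right_span p S"

definition right_finitely_generated :: "nat \<Rightarrow> 'a :: ring_1 fps vec set \<Rightarrow> bool" where
  "right_finitely_generated p M \<longleftrightarrow> (\<exists>S. finite S \<and> S \<subseteq> M \<and> right_span p S = M)"

definition shift_module :: "nat \<Rightarrow> nat \<Rightarrow> grassmann fps mat \<Rightarrow> grassmann fps vec set" where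
  "shift_module p q F = right_span p
     {(backward_shift ^^ n) F *\<^sub>v map_vec fps_const c | n c. 1 \<le> n \<and> c \<in> carrier_vec q}"

end

theory Submission
  imports Defs
begin

text \<open>The sign change \<open>i\<^sub>\<alpha> \<mapsto> (-1)\<^bsup>|\<alpha>|\<^esup> i\<^sub>\<alpha>\<close> is an automorphism whose fixed elements are central, and
  for every series \<open>P\<close> the product of \<open>P\<close> with its conjugate is fixed. Hence the star-rational
  series are the fractions \<open>d\<^sup>-\<^sup>\<star> \<star> P\<close> of polynomials with a central denominator \<open>d\<close>. This gives
  (2) with \<open>M\<^sub>2 = d I\<close>, and also (5), although the ring is not Noetherian: the
  coefficients of \<open>F\<close> satisfy a linear recurrence with central coefficients. Conversely,
  expressing the shift in a finite system of generators gives (4), which is the expansion of (3),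
  and Gaussian elimination on matrices with constant coefficient \<open>I\<close> shows that (2) and (3)
  imply (1).\<close>

section \<open>The grading automorphism\<close>

lift_definition gflip :: "grassmann \<Rightarrow> grassmann" is "\<lambda>x \<alpha>. (-1) ^ card \<alpha> * x \<alpha>"
  by (auto simp: norm_mult norm_power)

lemma gflip_add: "gflip (x + y) = gflip x + gflip y"
  by transfer (simp add: algebra_simps)

lemma gflip_zero [simp]: "gflip 0 = 0"
  by transfer simp

lemma gflip_sum: "gflip (sum f A) = (\<Sum>a\<in>A. gflip (f a))"
  by (induction A rule: infinite_finite_induct) (simp_all add: gflip_add)

lemma gflip_one [simp]: "gflip 1 = 1"
  by transfer auto

lemma gflip_gflip [simp]: "gflip (gflip x) = x"
  by transfer (simp add: mult.assoc[symmetric] power_add[symmetric])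

text \<open>In the coefficient at \<gamma> only pairs \<alpha>, \<gamma> - \<alpha> of complementary
  subsets occur. Their cardinalities add up to that of \<gamma>, so the signs multiply.\<close>

lemma gflip_mult: "gflip (x * y) = gflip x * gflip y"
proof (transfer, rule ext)
  fix x y :: "nat set \<Rightarrow> complex" and \<gamma> :: "nat set"
  have "(-1) ^ card \<gamma> = ((-1) ^ card \<alpha> * (-1) ^ card (\<gamma> - \<alpha>) :: complex)"
    if "finite \<gamma>" "\<alpha> \<subseteq> \<gamma>" for \<alpha>
    using that by (simp add: power_add[symmetric] card_Diff_subset finite_subset card_mono)
  then show "(-1) ^ card \<gamma> * gprod x y \<gamma> =
      gprod (\<lambda>\<alpha>. (-1) ^ card \<alpha> * x \<alpha>) (\<lambda>\<alpha>. (-1) ^ card \<alpha> * y \<alpha>) \<gamma>"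
    by (auto simp: gprod_def sum_distrib_left mult_ac intro!: sum.cong)
qed

text \<open>As \<alpha> and \<beta> are disjoint, the entries of a pair in \<alpha> \<times> \<beta>
  are distinct, so the pair is an inversion in exactly one of the two orders.\<close>

lemma inversions_swap:
  assumes "finite \<alpha>" "finite \<beta>" "\<alpha> \<inter> \<beta> = {}"
  shows "inversions \<alpha> \<beta> + inversions \<beta> \<alpha> = card \<alpha> * card \<beta>"
proof -
  let ?I = "{(a, b). a \<in> \<alpha> \<and> b \<in> \<beta> \<and> b < a}" and ?J = "{(b, a). b \<in> \<beta> \<and> a \<in> \<alpha> \<and> a < b}"
  have "card ?J = card (prod.swap ` ?J)"
    by (rule card_image[symmetric]) (auto intro: inj_onI)
  moreover have "\<alpha> \<times> \<beta> = ?I \<union> prod.swap ` ?J"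
    using assms(3) by (force simp: image_iff neq_iff)
  moreover have "card (?I \<union> prod.swap ` ?J) = card ?I + card (prod.swap ` ?J)"
    by (rule card_Un_disjoint) (use assms inversions_finite in auto)
  ultimately show ?thesis
    by (simp add: inversions_def card_cartesian_product[symmetric])
qed

lemma gsign_swap:
  assumes "finite \<alpha>" "finite \<beta>" "\<alpha> \<inter> \<beta> = {}"
  shows "gsign \<beta> \<alpha> = (-1) ^ (card \<alpha> * card \<beta>) * gsign \<alpha> \<beta>"
  unfolding gsign_def inversions_swap[OF assms, symmetric]
  by (simp add: power_add mult.assoc[symmetric] mult.commute power_mult_distrib[symmetric])

text \<open>Complementing the index set writes the reversed product with the same terms as
  \<open>gprod x y\<close>, each weighted by the sign of graded commutativity. The two orders can
  then be compared term by term.\<close>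

lemma gprod_swap:
  assumes "finite \<gamma>"
  shows "gprod y x \<gamma> = (\<Sum>\<alpha>\<in>Pow \<gamma>.
    (-1) ^ (card \<alpha> * card (\<gamma> - \<alpha>)) * (gsign \<alpha> (\<gamma> - \<alpha>) * x \<alpha> * y (\<gamma> - \<alpha>)))"
proof -
  have "gprod y x \<gamma> = (\<Sum>\<alpha>\<in>Pow \<gamma>. gsign \<alpha> (\<gamma> - \<alpha>) * y \<alpha> * x (\<gamma> - \<alpha>))"
    using assms by (simp add: gprod_def)
  also have "\<dots> = (\<Sum>\<alpha>\<in>Pow \<gamma>. gsign (\<gamma> - \<alpha>) \<alpha> * y (\<gamma> - \<alpha>) * x \<alpha>)"
    by (rule sum.reindex_bij_witness[where i = "\<lambda>\<alpha>. \<gamma> - \<alpha>" and j = "\<lambda>\<alpha>. \<gamma> - \<alpha>"])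
      (auto simp: double_diff)
  also have "\<dots> = (\<Sum>\<alpha>\<in>Pow \<gamma>.
      (-1) ^ (card \<alpha> * card (\<gamma> - \<alpha>)) * (gsign \<alpha> (\<gamma> - \<alpha>) * x \<alpha> * y (\<gamma> - \<alpha>)))"
    by (rule sum.cong) (use assms in \<open>auto simp: gsign_swap[of _ "\<gamma> - _"] finite_subset\<close>)
  finally show ?thesis .
qed

text \<open>A fixed element has no components of odd degree, and components of even degree commute
  with every basis element, since the exponent
  \<open>card \<alpha> * card (\<gamma> - \<alpha>)\<close> is then even.\<close>

lemma gflip_fixed_central:
  assumes "gflip x = x"
  shows "x * y = y * x"
  using assms
proof (transfer, elim conjE, intro ext)
  fix x y :: "nat set \<Rightarrow> complex" and \<gamma>
  assume fixed: "(\<lambda>\<alpha>. (-1) ^ card \<alpha> * x \<alpha>) = x"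
  have vanish: "x \<alpha> = 0" if "odd (card \<alpha>)" for \<alpha>
    using fun_cong[OF fixed, of \<alpha>] that by simp
  show "gprod x y \<gamma> = gprod y x \<gamma>"
  proof (cases "finite \<gamma>")
    case True
    have "gsign \<alpha> \<beta> * x \<alpha> * y \<beta> = (-1) ^ (card \<alpha> * card \<beta>) * (gsign \<alpha> \<beta> * x \<alpha> * y \<beta>)" for \<alpha> \<beta>
      by (cases "odd (card \<alpha>)") (simp_all add: vanish)
    then show ?thesis
      unfolding gprod_swap[OF True, where x = x and y = y]
      unfolding gprod_def if_P[OF True] by (intro sum.cong refl)
  qed (simp add: gprod_def)
qed

text \<open>The claim is that all coefficients of odd degree cancel. For odd
  \<open>card \<gamma>\<close> the sets \<alpha> and \<gamma> - \<alpha> have opposite parities, and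
  the contributions of \<alpha> to the two products are negatives of each other. The polarized form
  with two elements is what the Cauchy product of a series with its conjugate requires.\<close>

lemma gflip_polarization:
  "gflip (x * gflip y + y * gflip x) = x * gflip y + y * gflip x"
proof (transfer, elim conjE, intro ext)
  fix x y :: "nat set \<Rightarrow> complex" and \<gamma>
  let ?x = "\<lambda>\<alpha>. (-1) ^ card \<alpha> * x \<alpha>" and ?y = "\<lambda>\<alpha>. (-1) ^ card \<alpha> * y \<alpha>"
  show "(-1) ^ card \<gamma> * (gprod x ?y \<gamma> + gprod y ?x \<gamma>) = gprod x ?y \<gamma> + gprod y ?x \<gamma>"
  proof (cases "finite \<gamma> \<and> odd (card \<gamma>)")
    case True
    then have fin: "finite \<gamma>" and odd: "odd (card \<gamma>)" by auto
    have "(-1) ^ card (\<gamma> - \<alpha>) + (-1) ^ (card \<alpha> * card (\<gamma> - \<alpha>)) * (-1) ^ card \<alpha> = (0 :: complex)"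
      if "\<alpha> \<subseteq> \<gamma>" for \<alpha>
    proof -
      have "card \<alpha> + card (\<gamma> - \<alpha>) = card \<gamma>"
        using that fin by (simp add: card_Diff_subset finite_subset card_mono)
      then have "odd (card \<alpha> + card (\<gamma> - \<alpha>))" using odd by simp
      then show ?thesis by (cases "even (card \<alpha>)") auto
    qed
    \<comment> \<open>This factors the sum of the two contributions: \<open>s\<close> is the sign of
      the product, \<open>a\<close> and \<open>b\<close> are the coefficients of \<open>x\<close>
      and \<open>y\<close>, and \<open>k + l * m\<close> is the sum of powers of -1 just shown to
      vanish.\<close>
    moreover have "s * a * (k * b) + l * (s * (m * a) * b) = s * a * b * (k + l * m)"
      for s a b k l m :: complex
      by (simp add: algebra_simps)
    ultimately have "gsign \<alpha> (\<gamma> - \<alpha>) * x \<alpha> * ?y (\<gamma> - \<alpha>) +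
        (-1) ^ (card \<alpha> * card (\<gamma> - \<alpha>)) * (gsign \<alpha> (\<gamma> - \<alpha>) * ?x \<alpha> * y (\<gamma> - \<alpha>)) = 0"
      if "\<alpha> \<subseteq> \<gamma>" for \<alpha>
      using that by (simp only: mult_zero_right)
    then have "gprod x ?y \<gamma> + gprod y ?x \<gamma> = 0"
      unfolding gprod_swap[OF fin, where x = ?x and y = y] by (simp add: gprod_def fin sum.distrib[symmetric])
    then show ?thesis by simp
  qed (auto simp: gprod_def)
qed

section \<open>Extension of the sign change to power series\<close>

definition fps_gflip :: "grassmann fps \<Rightarrow> grassmann fps" where
  "fps_gflip f = Abs_fps (\<lambda>n. gflip (fps_nth f n))"

lemma fps_gflip_nth [simp]: "fps_nth (fps_gflip f) n = gflip (fps_nth f n)"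
  by (simp add: fps_gflip_def)

lemma fps_gflip_fixed_central:
  assumes "fps_gflip f = f"
  shows "f * g = g * f"
proof (rule fps_ext)
  fix n
  have fixed: "gflip (fps_nth f k) = fps_nth f k" for k
    using arg_cong[OF assms, of "\<lambda>f. fps_nth f k"] by simp
  have "fps_nth (f * g) n = (\<Sum>i=0..n. fps_nth g (n - i) * fps_nth f i)"
    by (simp add: fps_mult_nth gflip_fixed_central[OF fixed])
  also have "\<dots> = fps_nth (g * f) n"
    unfolding fps_mult_nth
    by (rule sum.reindex_bij_witness[where i = "\<lambda>i. n - i" and j = "\<lambda>i. n - i"]) auto
  finally show "fps_nth (f * g) n = fps_nth (g * f) n" .
qed

lemma fps_gflip_norm: "fps_gflip (f * fps_gflip f) = f * fps_gflip f"
proof (rule fps_ext)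
  fix n
  let ?s = "fps_nth (f * fps_gflip f) n"
  let ?h = "\<lambda>i. fps_nth f i * gflip (fps_nth f (n - i))"
  have s: "?s = (\<Sum>i=0..n. ?h i)"
    by (simp add: fps_mult_nth)
  also have "\<dots> = (\<Sum>i=0..n. ?h (n - i))"
    by (rule sum.reindex_bij_witness[where i = "\<lambda>i. n - i" and j = "\<lambda>i. n - i"]) auto
  \<comment> \<open>Adding the sum to its reversal pairs the indices i and n - i, and each summand
    takes the form covered by \<open>gflip_polarization\<close>.\<close>
  finally have "?s + ?s = (\<Sum>i=0..n. ?h i + ?h (n - i))"
    unfolding sum.distrib using s by simp
  then have double: "?s + ?s = (\<Sum>i=0..n. fps_nth f i * gflip (fps_nth f (n - i)) +
      fps_nth f (n - i) * gflip (fps_nth f i))" by simp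
  have "gflip (?s + ?s) = ?s + ?s"
    unfolding double gflip_sum gflip_polarization ..
  \<comment> \<open>Written as a real scalar, the factor 2 can be cancelled.\<close>
  then have "(2 :: real) *\<^sub>R gflip ?s = 2 *\<^sub>R ?s"
    by (simp only: gflip_add scaleR_2)
  then show "fps_nth (fps_gflip (f * fps_gflip f)) n = ?s"
    by simp
qed


section \<open>Polynomial series and star-rational series\<close>

definition fps_polynomial :: "'a :: zero fps \<Rightarrow> bool" where
  "fps_polynomial f \<longleftrightarrow> (\<exists>k. \<forall>n>k. fps_nth f n = 0)"

lemma fps_polynomial_const [simp]: "fps_polynomial (fps_const c)"
  by (auto simp: fps_polynomial_def)

lemma fps_polynomial_one [simp]: "fps_polynomial (1 :: 'a :: ring_1 fps)"
  using fps_polynomial_const[of "1 :: 'a"] by simp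

lemma fps_polynomial_X [simp]: "fps_polynomial (fps_X :: 'a :: ring_1 fps)"
  by (auto simp: fps_polynomial_def fps_X_def intro!: exI[of _ 1])

lemma fps_polynomial_add:
  fixes f g :: "'a :: ring_1 fps"
  assumes "fps_polynomial f" "fps_polynomial g"
  shows "fps_polynomial (f + g)"
proof -
  obtain k l where "\<forall>n>k. fps_nth f n = 0" "\<forall>n>l. fps_nth g n = 0"
    using assms by (auto simp: fps_polynomial_def)
  then show ?thesis
    unfolding fps_polynomial_def by (intro exI[of _ "max k l"]) auto
qed

lemma fps_polynomial_mult:
  fixes f g :: "'a :: ring_1 fps"
  assumes "fps_polynomial f" "fps_polynomial g"
  shows "fps_polynomial (f * g)"
proof -
  obtain k l where kl: "\<And>n. n > k \<Longrightarrow> fps_nth f n = 0" "\<And>n. n > l \<Longrightarrow> fps_nth g n = 0"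
    using assms by (auto simp: fps_polynomial_def)
  have "fps_nth (f * g) n = 0" if "n > k + l" for n
    unfolding fps_mult_nth
  proof (rule sum.neutral, rule ballI)
    fix i
    show "fps_nth f i * fps_nth g (n - i) = 0"
      using kl(1)[of i] kl(2)[of "n - i"] that by (cases "i > k") auto
  qed
  then show ?thesis
    unfolding fps_polynomial_def by blast
qed

lemma fps_polynomial_gflip:
  "fps_polynomial f \<Longrightarrow> fps_polynomial (fps_gflip f)"
  unfolding fps_polynomial_def fps_gflip_nth by (metis gflip_zero)

lemma poly_mat_iff:
  "poly_mat F \<longleftrightarrow> (\<forall>i<dim_row F. \<forall>j<dim_col F. fps_polynomial (F $$ (i, j)))"
proof
  assume "poly_mat F"
  then obtain k where k: "\<And>n. n > k \<Longrightarrow> coeff_mat F n = 0\<^sub>m (dim_row F) (dim_col F)"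
    by (auto simp: poly_mat_def)
  have "fps_nth (F $$ (i, j)) n = 0" if "i < dim_row F" "j < dim_col F" "n > k" for i j n
    using arg_cong[OF k[OF that(3)], of "\<lambda>M. M $$ (i, j)"] that by (simp add: coeff_mat_def)
  then show "\<forall>i<dim_row F. \<forall>j<dim_col F. fps_polynomial (F $$ (i, j))"
    unfolding fps_polynomial_def by blast
next
  assume "\<forall>i<dim_row F. \<forall>j<dim_col F. fps_polynomial (F $$ (i, j))"
  then obtain k where k: "\<And>i j n. i < dim_row F \<Longrightarrow> j < dim_col F \<Longrightarrow> n > k i j \<Longrightarrow>
      fps_nth (F $$ (i, j)) n = 0"
    unfolding fps_polynomial_def by metis
  \<comment> \<open>The sum of the finitely many degree bounds is a natural number above each of
    them, hence a common bound.\<close>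
  define K where "K = (\<Sum>i<dim_row F. \<Sum>j<dim_col F. k i j)"
  have "k i j \<le> K" if "i < dim_row F" "j < dim_col F" for i j
  proof -
    have "k i j \<le> (\<Sum>j<dim_col F. k i j)"
      using that by (intro member_le_sum) auto
    also have "\<dots> \<le> K"
      unfolding K_def using that by (intro member_le_sum) auto
    finally show ?thesis .
  qed
  then have "coeff_mat F n = 0\<^sub>m (dim_row F) (dim_col F)" if "n > K" for n
    by (intro eq_matI) (use that k in \<open>force simp: coeff_mat_def\<close>)+
  then show "poly_mat F"
    unfolding poly_mat_def by blast
qed

text \<open>The terms vanish beyond the degree, so the series converge for every \<open>z\<close>;
  the radius 1 is an arbitrary choice.\<close>

lemma poly_mat_in_Gamma:
  assumes "F \<in> carrier_mat p q" "poly_mat F"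
  shows "F \<in> Gamma p q"
proof -
  obtain k where k: "\<And>n. n > k \<Longrightarrow> coeff_mat F n = 0\<^sub>m p q"
    using assms by (auto simp: poly_mat_def)
  have "summable (\<lambda>n. z ^ n * coeff_mat F n $$ (i, j))" if "i < p" "j < q" for z i j
    by (rule summable_finite[of "{..k}"]) (use k that in \<open>auto simp: not_le\<close>)
  then show ?thesis
    using assms by (auto simp: Gamma_def intro!: exI[of _ 1])
qed

section \<open>Closure properties of the star-rational series\<close>

lemma star_rational_zero: "0 \<in> star_rational"
  using star_rational.const[of 0] by simp

lemma star_rational_sum:
  "(\<And>a. a \<in> A \<Longrightarrow> f a \<in> star_rational) \<Longrightarrow> sum f A \<in> star_rational"
  by (induction A rule: infinite_finite_induct) (auto intro: star_rational_zero star_rational.add)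

lemma star_rational_uminus:
  assumes "f \<in> star_rational"
  shows "- f \<in> star_rational"
proof -
  have "fps_const (- 1) * f \<in> star_rational"
    using assms by (intro star_rational.intros)
  then show ?thesis
    by (simp flip: fps_const_neg)
qed

lemma star_rational_diff:
  "f \<in> star_rational \<Longrightarrow> g \<in> star_rational \<Longrightarrow> f - g \<in> star_rational"
  using star_rational.add[of f "- g"] star_rational_uminus by auto

lemma star_rational_X_power: "fps_X ^ n \<in> star_rational"
proof (induction n)
  case 0
  then show ?case using star_rational.const[of 1] by simp
qed (auto intro: star_rational.intros)

lemma fps_polynomial_star_rational:
  fixes f :: "'a :: ring_1 fps"
  assumes "fps_polynomial f"
  shows "f \<in> star_rational"
proof -
  obtain k where k: "\<And>n. n > k \<Longrightarrow> fps_nth f n = 0"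
    using assms by (auto simp: fps_polynomial_def)
  have "f = (\<Sum>i\<le>k. fps_const (fps_nth f i) * fps_X ^ i)"
    by (rule fps_ext)
      (use k in \<open>auto simp: fps_sum_nth fps_X_power_mult_right_nth if_distrib not_le cong: if_cong\<close>)
  moreover have "\<dots> \<in> star_rational"
    by (intro star_rational_sum star_rational.mult star_rational.const star_rational_X_power)
  ultimately show ?thesis by simp
qed

text \<open>Gaussian elimination: the pivots \<open>1 - P n n\<close> have constant coefficient \<open>1\<close>, and this is
  preserved by the elimination steps.\<close>

lemma star_rational_solution:
  fixes P :: "nat \<Rightarrow> nat \<Rightarrow> 'a :: ring_1 fps"
  assumes "\<And>i j. i < n \<Longrightarrow> j < n \<Longrightarrow> P i j \<in> star_rational"
    and "\<And>i j. i < n \<Longrightarrow> j < n \<Longrightarrow> fps_nth (P i j) 0 = 0"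
    and "\<And>i. i < n \<Longrightarrow> g i \<in> star_rational"
    and "\<And>i. i < n \<Longrightarrow> x i = g i + (\<Sum>j<n. P i j * x j)"
    and "i < n"
  shows "x i \<in> star_rational"
  using assms
proof (induction n arbitrary: P g i)
  case (Suc n)
  define u where "u = star_inv (1 - P n n)"
  have one: "1 \<in> star_rational"
    using star_rational.const[of 1] by simp
  have p0: "fps_nth (1 - P n n) 0 = 1"
    using Suc.prems(2)[of n n] by simp
  have u: "u \<in> star_rational"
    unfolding u_def
    by (rule star_rational.inv) (use Suc.prems(1) p0 one in \<open>auto intro: star_rational_diff\<close>)
  have u1: "u * (1 - P n n) = 1"
    unfolding u_def by (rule star_inv(2)[of _ 1]) (use p0 in auto)
  define r where "r = g n + (\<Sum>j<n. P n j * x j)"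
  have "(1 - P n n) * x n = r"
    using Suc.prems(4)[of n] by (simp add: r_def algebra_simps)
  then have xn: "x n = u * r"
    using u1 by (metis mult.assoc mult_1)
  \<comment> \<open>Substituting \<open>x n = u * r\<close> into the remaining equations leaves a
    system of size \<open>n\<close>. The correction \<open>P i n * u * P n j\<close> is
    star-rational and has constant coefficient 0, so the new pivots are again of the required
    form.\<close>
  have IH: "x i \<in> star_rational" if "i < n" for i
  proof (rule Suc.IH[of "\<lambda>i j. P i j + P i n * u * P n j" "\<lambda>i. g i + P i n * u * g n"])
    fix i assume i: "i < n"
    show "x i = g i + P i n * u * g n + (\<Sum>j<n. (P i j + P i n * u * P n j) * x j)"
      using Suc.prems(4)[of i] i
      by (simp add: xn r_def algebra_simps sum.distrib sum_distrib_left)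
  qed (use that Suc.prems(1-3) u in \<open>auto intro!: star_rational.add star_rational.mult\<close>)
  have "x n \<in> star_rational"
    unfolding xn r_def
    by (intro star_rational.mult u star_rational.add star_rational_sum)
      (use Suc.prems(1,3) IH in auto)
  then show ?case
    using IH Suc.prems(5) by (auto simp: less_Suc_eq)
qed simp

section \<open>Star-rational matrices and their inverses\<close>

definition mat_star_rational :: "'a :: ring_1 fps mat \<Rightarrow> bool" where
  "mat_star_rational F \<longleftrightarrow> (\<forall>i<dim_row F. \<forall>j<dim_col F. F $$ (i, j) \<in> star_rational)"

lemma mat_star_rational_mult:
  assumes "F \<in> carrier_mat p m" "G \<in> carrier_mat m q" "mat_star_rational F" "mat_star_rational G"
  shows "mat_star_rational (F * G)"
  using assms unfolding mat_star_rational_def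
  by (auto simp: scalar_prod_def intro!: star_rational_sum star_rational.mult)

lemma mat_star_rational_add:
  assumes "F \<in> carrier_mat p q" "G \<in> carrier_mat p q" "mat_star_rational F" "mat_star_rational G"
  shows "mat_star_rational (F + G)"
  using assms unfolding mat_star_rational_def by (auto intro!: star_rational.add)

lemma mat_star_rational_const: "mat_star_rational (const_mat C)"
  by (simp add: mat_star_rational_def star_rational.const)

lemma coeff_mat_carrier: "F \<in> carrier_mat p q \<Longrightarrow> coeff_mat F n \<in> carrier_mat p q"
  by (simp add: coeff_mat_def)

text \<open>Multiplying from the left by \<open>V\<close>, the inverse of the constant coefficient,
  turns F X = I into X = V + P X with P = I - V F. Since P has constant coefficient 0, each column
  of X solves a system as in \<open>star_rational_solution\<close>.\<close>

lemma mat_star_rational_star_inv_mat: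
  fixes F :: "'a :: ring_1 fps mat"
  assumes F: "F \<in> carrier_mat N N" and rat: "mat_star_rational F"
    and inv: "invertible_mat (coeff_mat F 0)"
  shows "mat_star_rational (star_inv_mat F)"
proof -
  note F0 = coeff_mat_carrier[OF F, of 0]
  obtain W where FW: "coeff_mat F 0 * W = 1\<^sub>m N" and WF: "W * coeff_mat F 0 = 1\<^sub>m (dim_row W)"
    using inv F0 unfolding invertible_mat_def inverts_mat_def by auto
  have W: "W \<in> carrier_mat N N"
    using arg_cong[OF FW, of dim_col] arg_cong[OF WF, of dim_col] F0 by auto
  define V where "V = const_mat W"
  have V: "V \<in> carrier_mat N N" by (simp add: V_def W)
  define P where "P = 1\<^sub>m N - V * F"
  let ?X = "star_inv_mat F"
  note X = star_inv_mat[OF F inv]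
  have VF: "mat_star_rational (V * F)"
    by (rule mat_star_rational_mult[OF V F _ rat]) (simp add: V_def mat_star_rational_const)
  have P: "P $$ (i, j) \<in> star_rational" if "i < N" "j < N" for i j
  proof -
    have "(V * F) $$ (i, j) \<in> star_rational"
      using VF that V F by (auto simp: mat_star_rational_def)
    then show ?thesis
      using that V F star_rational_zero star_rational.const[of 1]
      by (auto simp: P_def intro!: star_rational_diff star_rational_uminus)
  qed
  have P0: "fps_nth (P $$ (i, j)) 0 = 0" if "i < N" "j < N" for i j
  proof -
    have "fps_nth ((V * F) $$ (i, j)) 0 = (W * coeff_mat F 0) $$ (i, j)"
      using that W F V
      by (simp add: V_def coeff_mat_def scalar_prod_def fps_sum_nth)
    then show ?thesis
      using that W V F by (simp add: P_def WF)
  qed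
  have "V * F * ?X = V"
    using V F X by (simp add: assoc_mult_mat[of _ N N _ N _ N])
  then have eq: "?X = V + P * ?X"
    using V F X unfolding P_def
    by (subst minus_mult_distrib_mat[of _ N N _ _ N]) auto
  have "?X $$ (i, j) \<in> star_rational" if ij: "i < N" "j < N" for i j
  proof (rule star_rational_solution[where n = N and P = "\<lambda>i k. P $$ (i, k)"
        and g = "\<lambda>i. V $$ (i, j)" and x = "\<lambda>i. ?X $$ (i, j)"])
    fix i assume i: "i < N"
    have "?X $$ (i, j) = (V + P * ?X) $$ (i, j)"
      using eq by simp
    also have "\<dots> = V $$ (i, j) + (\<Sum>k<N. P $$ (i, k) * ?X $$ (k, j))"
      using i ij V F X by (simp add: P_def scalar_prod_def atLeast0LessThan)
    finally show "?X $$ (i, j) = V $$ (i, j) + (\<Sum>k<N. P $$ (i, k) * ?X $$ (k, j))" .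
  qed (use ij W P P0 in \<open>auto simp: V_def star_rational.const\<close>)
  then show ?thesis
    using X by (auto simp: mat_star_rational_def)
qed


section \<open>Central denominators\<close>

text \<open>Centrality allows fractions to be added and multiplied as over a commutative ring; the
  invertible constant coefficient makes \<open>d\<close> invertible for the star product.\<close>

definition denominator :: "'a :: ring_1 fps \<Rightarrow> bool" where
  "denominator d \<longleftrightarrow> (\<forall>g. d * g = g * d) \<and> fps_polynomial d \<and>
     (\<exists>b. fps_nth d 0 * b = 1 \<and> b * fps_nth d 0 = 1)"

lemma denominator_central: "denominator d \<Longrightarrow> d * g = g * d"
  unfolding denominator_def by blast

lemma denominator_polynomial: "denominator d \<Longrightarrow> fps_polynomial d"
  unfolding denominator_def by blast

lemma denominator_one: "denominator (1 :: 'a :: ring_1 fps)"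
  by (auto simp: denominator_def intro!: exI[of _ 1])

lemma two_sided_inverse_mult:
  fixes a a' b b' :: "'a :: monoid_mult"
  assumes "a * b = 1" "b * a = 1" "a' * b' = 1" "b' * a' = 1"
  shows "a * a' * (b' * b) = 1" "b' * b * (a * a') = 1"
proof -
  have "a * a' * (b' * b) = a * (a' * b') * b" "b' * b * (a * a') = b' * (b * a) * a'"
    by (simp_all only: mult.assoc)
  then show "a * a' * (b' * b) = 1" "b' * b * (a * a') = 1"
    using assms by simp_all
qed

lemma denominator_mult:
  assumes "denominator d" "denominator e"
  shows "denominator (d * e)"
proof -
  have central: "d * g = g * d" "e * g = g * e" for g
    using assms denominator_central by blast+
  have comm: "d * e * g = g * (d * e)" for g
  proof -
    have "d * e * g = d * (g * e)"
      by (simp only: mult.assoc central(2)[of g])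
    also have "\<dots> = g * (d * e)"
      by (simp only: mult.assoc[symmetric] central(1)[of g])
    finally show ?thesis .
  qed
  obtain b c where "fps_nth d 0 * b = 1" "b * fps_nth d 0 = 1"
      "fps_nth e 0 * c = 1" "c * fps_nth e 0 = 1"
    using assms unfolding denominator_def by blast
  from two_sided_inverse_mult[OF this]
  have "\<exists>b. fps_nth (d * e) 0 * b = 1 \<and> b * fps_nth (d * e) 0 = 1"
    by auto
  moreover have "fps_polynomial (d * e)"
    using assms by (intro fps_polynomial_mult denominator_polynomial)
  ultimately show ?thesis
    unfolding denominator_def using comm by blast
qed

lemma fps_gflip_mult: "fps_gflip (f * g) = fps_gflip f * fps_gflip g"
  by (rule fps_ext) (simp add: fps_mult_nth gflip_sum gflip_mult)

lemma fps_gflip_gflip [simp]: "fps_gflip (fps_gflip f) = f"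
  by (rule fps_ext) simp

text \<open>For the inverse: if \<open>P = d f\<close>, then \<open>P\<close> times its conjugate is central and serves as
  a denominator of \<open>f\<^sup>-\<^sup>\<star>\<close>.\<close>

lemma star_rational_has_denominator:
  fixes f :: "grassmann fps"
  assumes "f \<in> star_rational"
  shows "\<exists>d. denominator d \<and> fps_polynomial (d * f)"
  using assms
proof induction
  case (const c)
  show ?case by (rule exI[of _ 1]) (simp add: denominator_one)
next
  case var
  show ?case by (rule exI[of _ 1]) (simp add: denominator_one)
next
  case (add f g)
  then obtain d e where de: "denominator d" "fps_polynomial (d * f)"
      "denominator e" "fps_polynomial (e * g)" by auto
  have "d * e = e * d" and poly: "fps_polynomial d" "fps_polynomial e"
    using de(1,3) denominator_central denominator_polynomial by blast+
  then have "d * e * (f + g) = e * (d * f) + d * (e * g)"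
    by (metis distrib_left mult.assoc)
  then have "fps_polynomial (d * e * (f + g))"
    using de(2,4) poly by (simp add: fps_polynomial_add fps_polynomial_mult)
  then show ?case
    using denominator_mult[OF de(1,3)] by blast
next
  case (mult f g)
  then obtain d e where de: "denominator d" "fps_polynomial (d * f)"
      "denominator e" "fps_polynomial (e * g)" by auto
  have "e * f = f * e"
    using de(3) by (rule denominator_central)
  then have "d * e * (f * g) = (d * f) * (e * g)"
    by (metis mult.assoc)
  then show ?case
    using de denominator_mult[of d e] by (metis fps_polynomial_mult)
next
  case (inv f)
  obtain a where a: "fps_nth f 0 * a = 1" "a * fps_nth f 0 = 1"
    using inv by auto
  obtain d b where d: "denominator d" "fps_polynomial (d * f)"
    and b: "fps_nth d 0 * b = 1" "b * fps_nth d 0 = 1"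
    using inv unfolding denominator_def by blast
  define P where "P = d * f"
  define N where "N = P * fps_gflip P"
  have N_fixed: "fps_gflip N = N"
    unfolding N_def by (rule fps_gflip_norm)
  \<comment> \<open>Conjugating N exchanges its two factors, and N is fixed.\<close>
  then have N': "N = fps_gflip P * P"
    by (simp add: N_def fps_gflip_mult)
  have P: "fps_polynomial P" and d_poly: "fps_polynomial d"
    using d by (simp_all add: P_def denominator_polynomial)
  have ab: "fps_nth P 0 * (a * b) = 1" "a * b * fps_nth P 0 = 1"
    using two_sided_inverse_mult[OF b a] by (simp_all add: P_def)
  \<comment> \<open>The flip is a unital ring homomorphism, so it carries an inverse of the constant
    coefficient of P to one for the conjugate of P. Their product inverts the constant coefficient
    of N.\<close>
  then have ab': "gflip (fps_nth P 0) * gflip (a * b) = 1" "gflip (a * b) * gflip (fps_nth P 0) = 1"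
    by (simp_all only: gflip_mult[symmetric] gflip_one)
  have "denominator N"
    unfolding denominator_def
  proof (intro conjI allI)
    show "N * g = g * N" for g
      by (rule fps_gflip_fixed_central[OF N_fixed])
    show "fps_polynomial N"
      unfolding N_def by (intro fps_polynomial_mult fps_polynomial_gflip P)
    show "\<exists>b. fps_nth N 0 * b = 1 \<and> b * fps_nth N 0 = 1"
      using two_sided_inverse_mult[OF ab ab'] by (auto simp: N_def)
  qed
  \<comment> \<open>In the form \<open>fps_gflip P * d * f\<close> the last factor of N cancels
    against the inverse of \<open>f\<close>, leaving a polynomial.\<close>
  moreover have "N * star_inv f = fps_gflip P * d"
    using star_inv(1)[OF a] by (simp add: N' P_def mult.assoc)
  then have "fps_polynomial (N * star_inv f)"
    by (simp add: fps_polynomial_mult fps_polynomial_gflip P d_poly)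
  ultimately show ?case by blast
qed

text \<open>Denominators are multiplied one after another; being central, a new one does not disturb
  the products that are already polynomial.\<close>

lemma common_denominator:
  fixes T :: "grassmann fps set"
  assumes "finite T" "T \<subseteq> star_rational"
  shows "\<exists>d. denominator d \<and> (\<forall>f\<in>T. fps_polynomial (d * f))"
  using assms
proof (induction T)
  case empty
  then show ?case using denominator_one by blast
next
  case (insert f T)
  then obtain d where d: "denominator d" "\<And>f. f \<in> T \<Longrightarrow> fps_polynomial (d * f)"
    by auto
  obtain e where e: "denominator e" "fps_polynomial (e * f)"
    using insert.prems star_rational_has_denominator by blast
  have poly: "fps_polynomial d" "fps_polynomial e"
    using d e by (simp_all add: denominator_polynomial)
  have "fps_polynomial (d * e * g)" if "g \<in> insert f T" for g
  proof (cases "g = f")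
    case True
    then show ?thesis
      using e poly by (simp add: mult.assoc fps_polynomial_mult)
  next
    case False
    have "d * e * g = e * (d * g)"
      using denominator_central[OF e(1)] by (metis mult.assoc)
    then show ?thesis
      using False that d poly by (auto intro: fps_polynomial_mult)
  qed
  then show ?case
    using denominator_mult[OF d(1) e(1)] by blast
qed

lemma common_denominator_mat:
  assumes "F \<in> carrier_mat p q" "entries_star_rational p q F"
  shows "\<exists>d. denominator d \<and> (\<forall>i<p. \<forall>j<q. fps_polynomial (d * F $$ (i, j)))"
proof -
  have "\<exists>d. denominator d \<and> (\<forall>f\<in>(\<lambda>(i, j). F $$ (i, j)) ` ({..<p} \<times> {..<q}). fps_polynomial (d * f))"
    by (rule common_denominator) (use assms in \<open>auto simp: entries_star_rational_def\<close>)
  then show ?thesis by force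
qed

lemma entries_star_rational_iff:
  "F \<in> carrier_mat p q \<Longrightarrow> entries_star_rational p q F \<longleftrightarrow> mat_star_rational F"
  by (auto simp: entries_star_rational_def mat_star_rational_def)


section \<open>Fractions and realizations\<close>

lemma polynomial_fraction_imp_star_rational:
  assumes "polynomial_fraction p q F"
  shows "entries_star_rational p q F"
proof -
  obtain m M1 M2 M3 where M: "M1 \<in> carrier_mat p m" "M2 \<in> carrier_mat m m" "M3 \<in> carrier_mat m q"
    and poly: "poly_mat M1" "poly_mat M2" "poly_mat M3"
    and inv: "invertible_mat (coeff_mat M2 0)" and F: "F = M1 * star_inv_mat M2 * M3"
    using assms by (auto simp: polynomial_fraction_def Gamma_def)
  have rat: "mat_star_rational M1" "mat_star_rational M2" "mat_star_rational M3"
    using poly by (auto simp: poly_mat_iff mat_star_rational_def intro: fps_polynomial_star_rational)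
  note X = star_inv_mat(1)[OF M(2) inv] and Xr = mat_star_rational_star_inv_mat[OF M(2) rat(2) inv]
  have "mat_star_rational F"
    unfolding F
    by (rule mat_star_rational_mult[OF mult_carrier_mat[OF M(1) X] M(3)
          mat_star_rational_mult[OF M(1) X rat(1) Xr] rat(3)])
  then show ?thesis
    using M X F by (subst entries_star_rational_iff) auto
qed

lemma smult_mat_mult:
  fixes a :: "'a :: ring_1"
  assumes "M \<in> carrier_mat p m" "N \<in> carrier_mat m q"
  shows "(a \<cdot>\<^sub>m M) * N = a \<cdot>\<^sub>m (M * N)"
  by (rule eq_matI) (use assms in \<open>auto simp: scalar_prod_def sum_distrib_left mult.assoc\<close>)

text \<open>With a common denominator \<open>d\<close> of all entries, the fraction is (d F) (d
  I)^{-1} I with inner size m = q, which has to be positive.\<close>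

lemma star_rational_imp_polynomial_fraction:
  assumes F: "F \<in> carrier_mat p q" and "q \<ge> 1" and rat: "entries_star_rational p q F"
  shows "polynomial_fraction p q F"
proof -
  obtain d where d: "denominator d" and dF: "\<And>i j. i < p \<Longrightarrow> j < q \<Longrightarrow> fps_polynomial (d * F $$ (i, j))"
    using common_denominator_mat[OF F rat] by blast
  obtain b where b: "fps_nth d 0 * b = 1" "b * fps_nth d 0 = 1"
    using d unfolding denominator_def by blast
  define M1 where "M1 = map_mat (\<lambda>f. d * f) F"
  define M2 where "M2 = d \<cdot>\<^sub>m 1\<^sub>m q"
  have M: "M1 \<in> carrier_mat p q" "M2 \<in> carrier_mat q q"
    using F by (simp_all add: M1_def M2_def)
  have poly: "poly_mat M1" "poly_mat M2" "poly_mat (1\<^sub>m q :: grassmann fps mat)"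
    using F d dF fps_polynomial_const[of "0 :: grassmann"]
    by (auto simp: poly_mat_iff M1_def M2_def denominator_polynomial)
  have M20: "coeff_mat M2 0 = fps_nth d 0 \<cdot>\<^sub>m 1\<^sub>m q"
    by (rule eq_matI) (auto simp: coeff_mat_def M2_def)
  have "a \<cdot>\<^sub>m 1\<^sub>m q * (c \<cdot>\<^sub>m 1\<^sub>m q) = a \<cdot>\<^sub>m (c \<cdot>\<^sub>m 1\<^sub>m q)" for a c :: grassmann
    by (subst smult_mat_mult[of _ q q _ q]) auto
  then have "fps_nth d 0 \<cdot>\<^sub>m 1\<^sub>m q * (b \<cdot>\<^sub>m 1\<^sub>m q) = (1\<^sub>m q :: grassmann mat)"
    "b \<cdot>\<^sub>m 1\<^sub>m q * (fps_nth d 0 \<cdot>\<^sub>m 1\<^sub>m q) = (1\<^sub>m q :: grassmann mat)"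
    by (auto simp: b)
  then have inv: "invertible_mat (coeff_mat M2 0)"
    unfolding M20 invertible_mat_def inverts_mat_def
    by (intro conjI exI[of _ "b \<cdot>\<^sub>m 1\<^sub>m q"]) auto
  \<comment> \<open>Right multiplication by d I multiplies the entries by \<open>d\<close> on the
    right, which by centrality is the same as on the left.\<close>
  have "M1 = F * M2"
    by (rule eq_matI) (use F in \<open>auto simp: M1_def M2_def scalar_prod_def if_distrib denominator_central[OF d] cong: if_cong\<close>)
  then have "M1 * star_inv_mat M2 * 1\<^sub>m q = F"
    using F M star_inv_mat[OF M(2) inv]
    by (simp add: assoc_mult_mat[of _ p q _ q _ q])
  then show ?thesis
    unfolding polynomial_fraction_def
    using \<open>q \<ge> 1\<close> M poly inv
    by (intro exI[of _ q] conjI bexI[of _ M1] bexI[of _ M2] bexI[of _ "1\<^sub>m q"] poly_mat_in_Gamma) auto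
qed

section \<open>Realizations and the expansion of the resolvent\<close>

lemma resolvent_carrier:
  fixes A :: "'a :: ring_1 mat"
  shows "A \<in> carrier_mat N N \<Longrightarrow> 1\<^sub>m N - fps_X \<cdot>\<^sub>m const_mat A \<in> carrier_mat N N"
  by (intro minus_carrier_mat smult_carrier_mat) simp

lemma coeff_mat_resolvent_0:
  fixes A :: "'a :: ring_1 mat"
  shows "A \<in> carrier_mat N N \<Longrightarrow> coeff_mat (1\<^sub>m N - fps_X \<cdot>\<^sub>m const_mat A) 0 = 1\<^sub>m N"
  by (rule eq_matI) (auto simp: coeff_mat_def)

text \<open>The entries of I - zA are polynomials and its constant coefficient is I, so its inverse
  has star-rational entries.\<close>

lemma realization_imp_star_rational:
  assumes "has_realization p q F"
  shows "entries_star_rational p q F"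
proof -
  obtain N A B C D where A: "A \<in> carrier_mat N N" and B: "B \<in> carrier_mat N q"
    and C: "C \<in> carrier_mat p N" and D: "D \<in> carrier_mat p q"
    and F: "F = const_mat D +
          (fps_X \<cdot>\<^sub>m const_mat C) * star_inv_mat (1\<^sub>m N - fps_X \<cdot>\<^sub>m const_mat A) * const_mat B"
    using assms by (auto simp: has_realization_def)
  let ?M = "1\<^sub>m N - fps_X \<cdot>\<^sub>m const_mat A"
  note M = resolvent_carrier[OF A]
  have inv: "invertible_mat (coeff_mat ?M 0)"
    unfolding coeff_mat_resolvent_0[OF A] by (simp add: invertible_mat_def inverts_mat_def exI[of _ "1\<^sub>m N"])
  have Mr: "mat_star_rational ?M"
    using A star_rational_zero star_rational.const[of 1]
    by (auto simp: mat_star_rational_def intro!: star_rational_diff star_rational_uminus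
        star_rational.mult star_rational.var star_rational.const)
  have Cr: "mat_star_rational (fps_X \<cdot>\<^sub>m const_mat C)"
    using C by (auto simp: mat_star_rational_def intro!: star_rational.intros)
  have C': "fps_X \<cdot>\<^sub>m const_mat C \<in> carrier_mat p N" and B': "const_mat B \<in> carrier_mat N q"
    using B C by auto
  note X = star_inv_mat(1)[OF M inv] and Xr = mat_star_rational_star_inv_mat[OF M Mr inv]
  let ?G = "(fps_X \<cdot>\<^sub>m const_mat C) * star_inv_mat ?M * const_mat B"
  have G: "?G \<in> carrier_mat p q"
    using X B' C' by auto
  have Gr: "mat_star_rational ?G"
    by (rule mat_star_rational_mult[OF mult_carrier_mat[OF C' X] B'
          mat_star_rational_mult[OF C' X Cr Xr] mat_star_rational_const])
  have D': "const_mat D \<in> carrier_mat p q"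
    using D by simp
  have "mat_star_rational F"
    unfolding F by (rule mat_star_rational_add[OF D' G mat_star_rational_const Gr])
  then show ?thesis
    using entries_star_rational_iff[of F p q] add_carrier_mat[OF G, of "const_mat D"] F by simp
qed

text \<open>This is the Neumann series of the powers z^n A^n. Checking that it is a left inverse
  suffices, because \<open>star_inv_mat\<close> is known to be a right inverse and the two must
  agree.\<close>

lemma star_inv_mat_resolvent:
  fixes A :: "'a :: ring_1 mat"
  assumes A: "A \<in> carrier_mat N N"
  shows "star_inv_mat (1\<^sub>m N - fps_X \<cdot>\<^sub>m const_mat A) =
    mat N N (\<lambda>(i, j). Abs_fps (\<lambda>n. (A ^\<^sub>m n) $$ (i, j)))"
proof -
  let ?M = "1\<^sub>m N - fps_X \<cdot>\<^sub>m const_mat A"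
  define G where "G = mat N N (\<lambda>(i, j). Abs_fps (\<lambda>n. (A ^\<^sub>m n) $$ (i, j)))"
  note M = resolvent_carrier[OF A]
  have G: "G \<in> carrier_mat N N"
    by (simp add: G_def)
  have inv: "invertible_mat (coeff_mat ?M 0)"
    unfolding coeff_mat_resolvent_0[OF A] by (simp add: invertible_mat_def inverts_mat_def exI[of _ "1\<^sub>m N"])
  have pow: "A ^\<^sub>m n \<in> carrier_mat N N" for n
    using A by (rule pow_carrier_mat)
  have "G * ?M = 1\<^sub>m N"
  proof (rule eq_matI)
    fix i j assume "i < dim_row (1\<^sub>m N :: 'a fps mat)" "j < dim_col (1\<^sub>m N :: 'a fps mat)"
    then have ij: "i < N" "j < N" by auto
    \<comment> \<open>Multiplying the series by zA on the right moves every power of A up by one and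
      removes the constant term, so the difference below telescopes to I.\<close>
    have GA: "(\<Sum>k<N. fps_nth (G $$ (i, k) * fps_X * fps_const (A $$ (k, j))) n) =
        (if n = 0 then 0 else (A ^\<^sub>m n) $$ (i, j))" for n
    proof (cases n)
      case (Suc m)
      have "(A ^\<^sub>m n) $$ (i, j) = (\<Sum>k<N. (A ^\<^sub>m m) $$ (i, k) * A $$ (k, j))"
        using ij A pow[of m] by (simp add: Suc scalar_prod_def atLeast0LessThan)
      then show ?thesis
        using ij by (simp add: Suc G_def)
    qed simp
    have "(G * ?M) $$ (i, j) =
        (\<Sum>k<N. G $$ (i, k) * ((if k = j then 1 else 0) - fps_X * fps_const (A $$ (k, j))))"
      using ij A G by (simp add: scalar_prod_def atLeast0LessThan)
    also have "\<dots> = G $$ (i, j) - (\<Sum>k<N. G $$ (i, k) * fps_X * fps_const (A $$ (k, j)))"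
    proof -
      have "G $$ (i, k) * ((if k = j then 1 else 0) - fps_X * fps_const (A $$ (k, j))) =
          (if k = j then G $$ (i, k) else 0) - G $$ (i, k) * fps_X * fps_const (A $$ (k, j))" for k
        by (simp add: right_diff_distrib mult.assoc)
      then show ?thesis
        using ij by (simp add: sum_subtractf)
    qed
    also have "\<dots> = 1\<^sub>m N $$ (i, j)"
      by (rule fps_ext) (simp only: fps_sub_nth fps_sum_nth GA, use ij A in \<open>simp add: G_def\<close>)
    finally show "(G * ?M) $$ (i, j) = 1\<^sub>m N $$ (i, j)" .
  qed (use M G in auto)
  then have "G = G * (?M * star_inv_mat ?M)"
    using star_inv_mat[OF M inv] G by simp
  also have "\<dots> = G * ?M * star_inv_mat ?M"
    using star_inv_mat[OF M inv] G M by (simp add: assoc_mult_mat[of _ N N _ N _ N])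
  also have "\<dots> = star_inv_mat ?M"
    using star_inv_mat[OF M inv] \<open>G * ?M = 1\<^sub>m N\<close> by simp
  finally show ?thesis by (simp add: G_def)
qed

text \<open>The factor z in front of C delays the Neumann series by one, which accounts for the
  exponent n - 1.\<close>

lemma nth_realization:
  fixes A :: "'a :: ring_1 mat"
  assumes A: "A \<in> carrier_mat N N" and B: "B \<in> carrier_mat N q"
    and C: "C \<in> carrier_mat p N" and D: "D \<in> carrier_mat p q" and ij: "i < p" "j < q"
  shows "fps_nth ((const_mat D +
      (fps_X \<cdot>\<^sub>m const_mat C) * star_inv_mat (1\<^sub>m N - fps_X \<cdot>\<^sub>m const_mat A) * const_mat B) $$ (i, j)) n =
    (if n = 0 then D $$ (i, j) else (C * A ^\<^sub>m (n - 1) * B) $$ (i, j))"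
proof -
  have pow: "A ^\<^sub>m n \<in> carrier_mat N N" for n
    using A by (rule pow_carrier_mat)
  show ?thesis
    using assms pow[of "n - 1"]
    by (auto simp: star_inv_mat_resolvent scalar_prod_def fps_sum_nth mult.assoc atLeast0LessThan
        sum_distrib_right)
qed

text \<open>The same four matrices serve on both sides; the equation between series is compared
  coefficient by coefficient.\<close>

lemma realization_iff_coefficient_formula:
  assumes F: "F \<in> carrier_mat p q"
  shows "has_realization p q F \<longleftrightarrow> has_coefficient_formula p q F"
proof -
  have "F = const_mat D +
      (fps_X \<cdot>\<^sub>m const_mat C) * star_inv_mat (1\<^sub>m N - fps_X \<cdot>\<^sub>m const_mat A) * const_mat B \<longleftrightarrow>
    coeff_mat F 0 = D \<and> (\<forall>n\<ge>1. coeff_mat F n = C * A ^\<^sub>m (n - 1) * B)" (is "F = ?R \<longleftrightarrow> ?rhs")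
    if A: "A \<in> carrier_mat N N" and B: "B \<in> carrier_mat N q"
      and C: "C \<in> carrier_mat p N" and D: "D \<in> carrier_mat p q" for N A B C D
  proof -
    note nth = nth_realization[OF A B C D]
    have R: "?R \<in> carrier_mat p q"
      using A B C D by auto
    have "F = ?R \<longleftrightarrow> (\<forall>i<p. \<forall>j<q. \<forall>n. fps_nth (F $$ (i, j)) n = fps_nth (?R $$ (i, j)) n)"
      using carrier_matD[OF F] carrier_matD[OF R] unfolding mat_eq_iff fps_eq_iff by simp
    also have "\<dots> \<longleftrightarrow> (\<forall>n. \<forall>i<p. \<forall>j<q. fps_nth (F $$ (i, j)) n =
        (if n = 0 then D $$ (i, j) else (C * A ^\<^sub>m (n - 1) * B) $$ (i, j)))"
      using nth by auto
    also have "\<dots> \<longleftrightarrow> (\<forall>n. coeff_mat F n = (if n = 0 then D else C * A ^\<^sub>m (n - 1) * B))"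
      using F B C D by (intro all_cong1) (auto simp: mat_eq_iff coeff_mat_def)
    also have "\<dots> \<longleftrightarrow> ?rhs"
      by (auto simp: Suc_le_eq)
    finally show ?thesis .
  qed
  then show ?thesis
    unfolding has_realization_def has_coefficient_formula_def by (intro ex_cong1 conj_cong bex_cong refl) auto
qed


section \<open>The module of backward shifts\<close>

lemma dim_right_scale [simp]: "dim_vec (right_scale v c) = dim_vec v"
  by (simp add: right_scale_def)

lemma index_right_scale [simp]:
  "i < dim_vec v \<Longrightarrow> right_scale v c $ i = v $ i * fps_const c"
  by (simp add: right_scale_def)

lemma right_span_dim:
  assumes "S \<subseteq> carrier_vec p" "v \<in> right_span p S"
  shows "dim_vec v = p"
  using assms(2) by induction (use assms(1) in auto)

text \<open>The inductive definition adds one multiple of a generator at a time, so closure under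
  sums of arbitrary elements needs an induction on the second summand.\<close>

lemma right_span_add:
  assumes S: "S \<subseteq> carrier_vec p" and v: "v \<in> right_span p S" and w: "w \<in> right_span p S"
  shows "v + w \<in> right_span p S"
  using w
proof induction
  case zero
  have "v + 0\<^sub>v p = v"
    using right_span_dim[OF S v] by (intro eq_vecI) auto
  then show ?case using v by simp
next
  case (add w u c)
  have "v + (w + right_scale u c) = (v + w) + right_scale u c"
    using right_span_dim[OF S v] right_span_dim[OF S add.hyps(1)] add.hyps(2) S
    by (intro eq_vecI) (auto simp: add.assoc)
  then show ?case
    using right_span.add[OF add.IH add.hyps(2)] by simp
qed

lemma right_span_scale:
  assumes S: "S \<subseteq> carrier_vec p" and w: "w \<in> right_span p S"
  shows "right_scale w c \<in> right_span p S"
  using w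
proof induction
  case zero
  have "right_scale (0\<^sub>v p) c = 0\<^sub>v p"
    by (intro eq_vecI) auto
  then show ?case using right_span.zero by metis
next
  case (add w u b)
  have "right_scale (w + right_scale u b) c = right_scale w c + right_scale u (b * c)"
    using right_span_dim[OF S add.hyps(1)] add.hyps(2) S
    by (intro eq_vecI) (auto simp: distrib_right mult.assoc)
  then show ?case
    using right_span.add[OF add.IH add.hyps(2)] by simp
qed

lemma right_span_base:
  assumes "S \<subseteq> carrier_vec p" "v \<in> S"
  shows "v \<in> right_span p S"
proof -
  have "0\<^sub>v p + right_scale v 1 = v"
    using assms by (intro eq_vecI) auto
  then show ?thesis
    using right_span.add[OF right_span.zero assms(2), of p 1] by simp
qed

lemma right_span_minimal:
  assumes T: "T \<subseteq> carrier_vec p" and sub: "S \<subseteq> right_span p T"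
  shows "right_span p S \<subseteq> right_span p T"
proof
  fix w assume "w \<in> right_span p S"
  then show "w \<in> right_span p T"
    by induction (use sub T in \<open>auto intro: right_span.zero right_span_add right_span_scale\<close>)
qed

lemma right_span_sum:
  assumes S: "S \<subseteq> carrier_vec p" and fin: "finite K" and v: "\<And>k. k \<in> K \<Longrightarrow> v k \<in> right_span p S"
  shows "vec p (\<lambda>i. \<Sum>k\<in>K. v k $ i * fps_const (c k)) \<in> right_span p S"
  using fin v
proof (induction K)
  case empty
  have "vec p (\<lambda>i. \<Sum>k\<in>{}. v k $ i * fps_const (c k)) = 0\<^sub>v p"
    by (intro eq_vecI) auto
  then show ?case
    using right_span.zero by metis
next
  case (insert k K)
  have "vec p (\<lambda>i. \<Sum>k\<in>insert k K. v k $ i * fps_const (c k)) =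
      right_scale (v k) (c k) + vec p (\<lambda>i. \<Sum>k\<in>K. v k $ i * fps_const (c k))"
    using insert right_span_dim[OF S, of "v k"] by (intro eq_vecI) auto
  then show ?case
    using insert by (auto intro!: right_span_add[OF S] right_span_scale[OF S])
qed

text \<open>Indexing the generators by list positions gives coordinate vectors, from which the
  columns of the state matrices are later read.\<close>

lemma right_span_list:
  assumes xs: "set xs \<subseteq> carrier_vec p" and v: "v \<in> right_span p (set xs)"
  shows "\<exists>c. \<forall>i<p. v $ i = (\<Sum>k<length xs. xs ! k $ i * fps_const (c k))"
  using v
proof induction
  case zero
  show ?case by (rule exI[of _ "\<lambda>_. 0"]) simp
next
  case (add w u a)
  obtain c where c: "\<And>i. i < p \<Longrightarrow> w $ i = (\<Sum>k<length xs. xs ! k $ i * fps_const (c k))"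
    using add.IH by blast
  obtain l where l: "l < length xs" "u = xs ! l"
    using add.hyps(2) by (auto simp: in_set_conv_nth)
  have "dim_vec u = p"
    using add.hyps(2) xs by auto
  moreover have "xs ! k $ i * fps_const (c k + (if k = l then a else 0)) =
      xs ! k $ i * fps_const (c k) + (if k = l then xs ! k $ i * fps_const a else 0)" for i k
    by (simp add: distrib_left flip: fps_const_add)
  \<comment> \<open>Only the coefficient at the chosen position \<open>l\<close> is changed, so the
    multiple of \<open>u\<close> is counted once even if \<open>u\<close> occurs repeatedly in the
    list.\<close>
  ultimately show ?case
    using l by (intro exI[of _ "\<lambda>k. c k + (if k = l then a else 0)"]) (auto simp: c sum.distrib)
qed

section \<open>The backward shift on spans and on columns of F\<close>

lemma fps_shift_sum: "fps_shift n (sum f A) = (\<Sum>a\<in>A. fps_shift n (f a))"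
  by (rule fps_ext) (simp add: fps_sum_nth)

lemma fps_shift_mult_const: "fps_shift n (f * fps_const c) = fps_shift n f * fps_const c"
  for f :: "'a :: ring_1 fps"
  by (rule fps_ext) simp

text \<open>The shift acts on coefficients and so commutes with right multiplication by constants;
  stability need only be known on generators.\<close>

lemma right_span_shift:
  fixes S :: "'a :: ring_1 fps vec set"
  assumes S: "S \<subseteq> carrier_vec p" and shift: "map_vec (fps_shift 1) ` S \<subseteq> right_span p S"
    and w: "w \<in> right_span p S"
  shows "map_vec (fps_shift 1) w \<in> right_span p S"
  using w
proof induction
  case zero
  have "map_vec (fps_shift 1) (0\<^sub>v p) = (0\<^sub>v p :: 'a fps vec)"
    by (intro eq_vecI) auto
  then show ?case using right_span.zero by metis
next
  case (add w u c)
  have "map_vec (fps_shift 1) (w + right_scale u c) =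
      map_vec (fps_shift 1) w + right_scale (map_vec (fps_shift 1) u) c"
    using right_span_dim[OF S add.hyps(1)] add.hyps(2) S
    by (intro eq_vecI) (auto simp: fps_shift_add fps_shift_mult_const)
  then show ?case
    using add shift by (auto intro!: right_span_add[OF S] right_span_scale[OF S])
qed

lemma fps_shift_1_shift: "fps_shift 1 (fps_shift n f) = fps_shift (Suc n) f"
  by (rule fps_ext) simp

lemma backward_shift_funpow: "(backward_shift ^^ n) F = map_mat (fps_shift n) F"
proof (induction n)
  case 0
  show ?case by (rule eq_matI) auto
next
  case (Suc n)
  have "backward_shift (map_mat (fps_shift n) F) = map_mat (fps_shift (Suc n)) F"
    by (rule eq_matI) (simp_all only: backward_shift_def index_map_mat fps_shift_1_shift)
  then show ?case by (simp add: Suc)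
qed

definition shift_column :: "grassmann fps mat \<Rightarrow> nat \<Rightarrow> grassmann vec \<Rightarrow> grassmann fps vec" where
  "shift_column F n c = (backward_shift ^^ n) F *\<^sub>v map_vec fps_const c"

lemma shift_column_carrier: "F \<in> carrier_mat p q \<Longrightarrow> shift_column F n c \<in> carrier_vec p"
  by (intro carrier_vecI) (simp add: shift_column_def backward_shift_funpow)

lemma shift_column_nth:
  assumes "F \<in> carrier_mat p q" "c \<in> carrier_vec q" "i < p"
  shows "shift_column F n c $ i = (\<Sum>j<q. fps_shift n (F $$ (i, j)) * fps_const (c $ j))"
  using assms by (simp add: shift_column_def backward_shift_funpow scalar_prod_def atLeast0LessThan)

lemma shift_column_unit_nth:
  assumes "F \<in> carrier_mat p q" "i < p" "j < q"
  shows "shift_column F n (unit_vec q j) $ i = fps_shift n (F $$ (i, j))"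
proof -
  have "fps_shift n (F $$ (i, k)) * fps_const (unit_vec q j $ k) =
      (if k = j then fps_shift n (F $$ (i, k)) else 0)" if "k < q" for k
    using that assms(3) by auto
  then show ?thesis
    using assms by (simp add: shift_column_nth)
qed

lemma shift_module_eq:
  "shift_module p q F = right_span p {shift_column F n c | n c. 1 \<le> n \<and> c \<in> carrier_vec q}"
  by (simp add: shift_module_def shift_column_def)

lemma shift_shift_column:
  assumes F: "F \<in> carrier_mat p q" and c: "c \<in> carrier_vec q"
  shows "map_vec (fps_shift 1) (shift_column F n c) = shift_column F (Suc n) c"
proof (rule eq_vecI)
  have dim: "dim_vec (shift_column F n c) = p" for n
    using shift_column_carrier[OF F] by (rule carrier_vecD)
  then show "dim_vec (map_vec (fps_shift 1) (shift_column F n c)) = dim_vec (shift_column F (Suc n) c)"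
    by simp
  fix i assume "i < dim_vec (shift_column F (Suc n) c)"
  then have i: "i < p" by (simp only: dim)
  then have "map_vec (fps_shift 1) (shift_column F n c) $ i = fps_shift 1 (shift_column F n c $ i)"
    by (simp add: dim)
  then show "map_vec (fps_shift 1) (shift_column F n c) $ i = shift_column F (Suc n) c $ i"
    by (simp only: shift_column_nth[OF F c i] fps_shift_sum fps_shift_mult_const fps_shift_1_shift)
qed

text \<open>The generators form a state space: A expresses the shift on them, B expresses the
  columns of the shifted series, and C evaluates them at 0. The module is stable under the shift
  because shifting a spanning column raises \<open>n\<close> by one.\<close>

lemma finitely_generated_imp_coefficient_formula:
  assumes F: "F \<in> carrier_mat p q" and fg: "right_finitely_generated p (shift_module p q F)"
  shows "has_coefficient_formula p q F"
proof -
  define T where "T = {shift_column F n c | n c. 1 \<le> n \<and> c \<in> carrier_vec q}"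
  have M: "shift_module p q F = right_span p T"
    by (simp add: shift_module_eq T_def)
  have T: "T \<subseteq> carrier_vec p"
    using shift_column_carrier[OF F] by (auto simp: T_def)
  have "map_vec (fps_shift 1) ` T \<subseteq> T"
    using shift_shift_column[OF F] by (fastforce simp: T_def)
  then have shiftT: "map_vec (fps_shift 1) ` T \<subseteq> right_span p T"
    using right_span_base[OF T] by blast
  obtain S where S: "finite S" "S \<subseteq> right_span p T" "right_span p S = right_span p T"
    using fg by (auto simp: right_finitely_generated_def M)
  \<comment> \<open>The zero column is added because the state space must have positive dimension.\<close>
  obtain xs where xs: "set xs = insert (0\<^sub>v p) S"
    using finite_list[of "insert (0\<^sub>v p) S"] S(1) by auto
  define N where "N = length xs"
  have "N \<ge> 1"
    using xs by (cases xs) (auto simp: N_def)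
  have xsT: "set xs \<subseteq> right_span p T"
    using S(2) xs right_span.zero by auto
  then have xsc: "set xs \<subseteq> carrier_vec p"
    using right_span_dim[OF T] by (blast intro: carrier_vecI)
  have "right_span p S \<subseteq> right_span p (set xs)"
    by (rule right_span_minimal[OF xsc]) (use xs right_span_base[OF xsc] in auto)
  then have comb: "\<exists>c. \<forall>i<p. v $ i = (\<Sum>k<N. xs ! k $ i * fps_const (c k))"
    if "v \<in> right_span p T" for v
    unfolding N_def using right_span_list[OF xsc] S(3) that by blast
  have "\<exists>c. \<forall>i<p. map_vec (fps_shift 1) (xs ! j) $ i = (\<Sum>k<N. xs ! k $ i * fps_const (c k))"
    if "j < N" for j
    by (intro comb right_span_shift[OF T shiftT]) (use that xsT in \<open>auto simp: N_def\<close>)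
  then obtain a where a: "\<And>i j. j < N \<Longrightarrow> i < p \<Longrightarrow>
      map_vec (fps_shift 1) (xs ! j) $ i = (\<Sum>k<N. xs ! k $ i * fps_const (a j k))"
    by metis
  have "\<exists>c. \<forall>i<p. shift_column F 1 (unit_vec q j) $ i = (\<Sum>k<N. xs ! k $ i * fps_const (c k))"
    for j
    by (intro comb right_span_base[OF T]) (unfold T_def, use unit_vec_carrier in blast)
  then obtain b where b: "\<And>i j. i < p \<Longrightarrow>
      shift_column F 1 (unit_vec q j) $ i = (\<Sum>k<N. xs ! k $ i * fps_const (b j k))"
    by metis
  \<comment> \<open>Coordinates fill the columns of A and B, since the scalars act on the
    right.\<close>
  define A where "A = mat N N (\<lambda>(k, j). a j k)"
  define B where "B = mat N q (\<lambda>(k, j). b j k)"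
  define C where "C = mat p N (\<lambda>(i, k). fps_nth (xs ! k $ i) 0)"
  have carrier: "A \<in> carrier_mat N N" "B \<in> carrier_mat N q" "C \<in> carrier_mat p N"
    by (simp_all add: A_def B_def C_def)
  have pow: "A ^\<^sub>m n \<in> carrier_mat N N" for n
    using carrier(1) by (rule pow_carrier_mat)
  have dim: "dim_vec (xs ! j) = p" if "j < N" for j
    using that xsc nth_mem[of j xs] unfolding N_def by (blast intro: carrier_vecD)
  \<comment> \<open>The coefficient at \<open>n\<close> of a generator is found by shifting it
    \<open>n\<close> times and evaluating at 0; each shift contributes one factor A on the
    right.\<close>
  have state: "fps_nth (xs ! j $ i) n = (C * A ^\<^sub>m n) $$ (i, j)" if "i < p" "j < N" for i j n
    using that
  proof (induction n arbitrary: j)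
    case 0
    then show ?case using carrier by (simp add: C_def)
  next
    case (Suc n)
    have "fps_nth (xs ! j $ i) (Suc n) = fps_nth (map_vec (fps_shift 1) (xs ! j) $ i) n"
      using Suc.prems dim by simp
    also have "\<dots> = (\<Sum>k<N. fps_nth (xs ! k $ i) n * A $$ (k, j))"
      unfolding a[OF Suc.prems(2,1)] using Suc.prems by (simp add: fps_sum_nth A_def)
    also have "\<dots> = (\<Sum>k<N. (C * A ^\<^sub>m n) $$ (i, k) * A $$ (k, j))"
      using Suc by simp
    also have "\<dots> = (C * A ^\<^sub>m n * A) $$ (i, j)"
      using Suc.prems carrier pow[of n] by (simp add: scalar_prod_def atLeast0LessThan)
    also have "C * A ^\<^sub>m n * A = C * A ^\<^sub>m Suc n"
      using carrier pow[of n] by (simp add: assoc_mult_mat[of _ p N _ N _ N])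
    finally show ?case .
  qed
  have "coeff_mat F n = C * A ^\<^sub>m (n - 1) * B" if "n \<ge> 1" for n
  proof (rule eq_matI)
    fix i j assume "i < dim_row (C * A ^\<^sub>m (n - 1) * B)" "j < dim_col (C * A ^\<^sub>m (n - 1) * B)"
    then have ij: "i < p" "j < q" using carrier by auto
    \<comment> \<open>The module starts with the first shift of F, so the coefficient at
      \<open>n\<close> of F appears there at \<open>n - 1\<close>.\<close>
    have "coeff_mat F n $$ (i, j) = fps_nth (shift_column F 1 (unit_vec q j) $ i) (n - 1)"
      using ij F that by (simp add: shift_column_unit_nth[OF F] coeff_mat_def)
    also have "\<dots> = (\<Sum>k<N. (C * A ^\<^sub>m (n - 1)) $$ (i, k) * B $$ (k, j))"
      unfolding b[OF ij(1)] using ij by (simp add: fps_sum_nth B_def state)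
    also have "\<dots> = (C * A ^\<^sub>m (n - 1) * B) $$ (i, j)"
      using ij carrier pow[of "n - 1"] by (simp add: scalar_prod_def atLeast0LessThan)
    finally show "coeff_mat F n $$ (i, j) = (C * A ^\<^sub>m (n - 1) * B) $$ (i, j)" .
  qed (use F carrier in \<open>auto simp: coeff_mat_def\<close>)
  then show ?thesis
    unfolding has_coefficient_formula_def
    using \<open>N \<ge> 1\<close> carrier coeff_mat_carrier[OF F, of 0]
    by (intro exI[of _ N] conjI bexI[of _ A] bexI[of _ B] bexI[of _ C] bexI[of _ "coeff_mat F 0"]) auto
qed

text \<open>Since the coefficients of a denominator are central, the linear recurrence that it gives for
  the coefficients of \<open>F\<close> can be read with scalars on the right.\<close>

lemma star_rational_imp_finitely_generated:
  assumes F: "F \<in> carrier_mat p q" and rat: "entries_star_rational p q F"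
  shows "right_finitely_generated p (shift_module p q F)"
proof -
  obtain d where d: "denominator d" and dF: "\<And>i j. i < p \<Longrightarrow> j < q \<Longrightarrow> fps_polynomial (d * F $$ (i, j))"
    using common_denominator_mat[OF F rat] by blast
  obtain b where b: "fps_nth d 0 * b = 1" "b * fps_nth d 0 = 1"
    using d unfolding denominator_def by blast
  have "poly_mat (map_mat (\<lambda>f. d * f) F)"
    using F dF by (simp add: poly_mat_iff)
  then obtain K where K: "\<And>n. n > K \<Longrightarrow> coeff_mat (map_mat (\<lambda>f. d * f) F) n = 0\<^sub>m p q"
    using F by (auto simp: poly_mat_def)
  have dF0: "fps_nth (d * F $$ (i, j)) n = 0" if "i < p" "j < q" "n > K" for i j n
    using arg_cong[OF K[OF that(3)], of "\<lambda>M. M $$ (i, j)"] that F by (simp add: coeff_mat_def)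
  obtain K' where K': "\<And>n. n > K' \<Longrightarrow> fps_nth d n = 0"
    using denominator_polynomial[OF d] by (auto simp: fps_polynomial_def)
  \<comment> \<open>Beyond L the coefficients of both \<open>d F\<close> and \<open>d\<close>
    vanish, so the recurrence is homogeneous and has length L.\<close>
  define L where "L = max K K'"
  \<comment> \<open>These scalars arise from solving the convolution with \<open>d\<close> for its
    leading term, \<open>b\<close> being the inverse of the constant coefficient of
    \<open>d\<close>.\<close>
  define e where "e u = - (fps_nth d u * b)" for u
  have d_central: "fps_nth d u * x = x * fps_nth d u" for u x
    using arg_cong[OF denominator_central[OF d, of "fps_const x"], of "\<lambda>f. fps_nth f u"] by simp
  have b_central: "b * x = x * b" for x
  proof -
    \<comment> \<open>The inverse of a central element is central: d_0 b = 1 is inserted on the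
      right and d_0 moved to the left.\<close>
    have "b * x = b * (x * fps_nth d 0) * b"
      by (simp add: mult.assoc b)
    also have "\<dots> = x * b"
      by (simp add: d_central[symmetric] mult.assoc[symmetric] b)
    finally show ?thesis .
  qed
  have recurrence: "fps_nth (F $$ (i, j)) n = (\<Sum>u=1..L. fps_nth (F $$ (i, j)) (n - u) * e u)"
    if "i < p" "j < q" "n > L" for i j n
  proof -
    let ?f = "fps_nth (F $$ (i, j))"
    have "0 = (\<Sum>u=0..n. fps_nth d u * ?f (n - u))"
      using dF0[of i j n] that by (simp add: L_def fps_mult_nth)
    also have "\<dots> = (\<Sum>u=0..L. fps_nth d u * ?f (n - u))"
      by (rule sum.mono_neutral_right) (use that K' in \<open>auto simp: L_def\<close>)
    also have "\<dots> = fps_nth d 0 * ?f n + (\<Sum>u=1..L. fps_nth d u * ?f (n - u))"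
      by (subst sum.atLeast_Suc_atMost) auto
    finally have "fps_nth d 0 * ?f n = - (\<Sum>u=1..L. fps_nth d u * ?f (n - u))"
      by (simp add: eq_neg_iff_add_eq_0)
    then have "b * (fps_nth d 0 * ?f n) = (\<Sum>u=1..L. - (b * (fps_nth d u * ?f (n - u))))"
      by (simp add: sum_distrib_left sum_negf)
    moreover have "- (b * (fps_nth d u * x)) = x * e u" for u x
    proof -
      have "b * (fps_nth d u * x) = x * (fps_nth d u * b)"
        by (simp only: d_central[of u x] b_central[of "x * fps_nth d u"] mult.assoc)
      then show ?thesis
        by (simp add: e_def)
    qed
    ultimately show ?thesis
      by (simp add: mult.assoc[symmetric] b)
  qed
  define T where "T = {shift_column F n c | n c. 1 \<le> n \<and> c \<in> carrier_vec q}"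
  \<comment> \<open>The first L shifts of the columns of F are to generate; the recurrence reduces
    every later shift to them.\<close>
  define S where "S = (\<lambda>(n, j). shift_column F n (unit_vec q j)) ` ({1..L} \<times> {..<q})"
  have T: "T \<subseteq> carrier_vec p"
    using shift_column_carrier[OF F] by (auto simp: T_def)
  have ST: "S \<subseteq> T"
    by (force simp: S_def T_def)
  then have S: "S \<subseteq> carrier_vec p"
    using T by blast
  have unit: "shift_column F n (unit_vec q j) \<in> right_span p S" if "n \<ge> 1" "j < q" for n j
    using that
  proof (induction n rule: less_induct)
    case (less n)
    show ?case
    proof (cases "n \<le> L")
      case True
      then show ?thesis
        using less.prems by (intro right_span_base[OF S]) (force simp: S_def)
    next
      case False
      have "shift_column F n (unit_vec q j) =
          vec p (\<lambda>i. \<Sum>u=1..L. shift_column F (n - u) (unit_vec q j) $ i * fps_const (e u))"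
      proof (intro eq_vecI)
        fix i assume "i < dim_vec (vec p
            (\<lambda>i. \<Sum>u=1..L. shift_column F (n - u) (unit_vec q j) $ i * fps_const (e u)))"
        then have i: "i < p" by simp
        \<comment> \<open>For n > L and u \<le> L the index n - u is positive, so (m + n) - u = m +
          (n - u) holds in the natural numbers and the induction hypothesis covers the shift by n -
          u.\<close>
        have "fps_nth (F $$ (i, j)) (m + n) =
            (\<Sum>u=1..L. fps_nth (F $$ (i, j)) (m + (n - u)) * e u)" for m
          using recurrence[OF i less.prems(2), of "m + n"] False
          by (auto intro!: sum.cong arg_cong[of _ _ "fps_nth _"])
        then show "shift_column F n (unit_vec q j) $ i = vec p
            (\<lambda>i. \<Sum>u=1..L. shift_column F (n - u) (unit_vec q j) $ i * fps_const (e u)) $ i"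
          using i less.prems(2)
          by (auto simp: shift_column_unit_nth[OF F] fps_eq_iff fps_sum_nth add.commute)
      qed (use shift_column_carrier[OF F] in auto)
      also have "\<dots> \<in> right_span p S"
        using False less.prems by (intro right_span_sum[OF S] less.IH) auto
      finally show ?thesis .
    qed
  qed
  have "T \<subseteq> right_span p S"
  proof
    fix v assume "v \<in> T"
    then obtain n c where v: "v = shift_column F n c" and n: "n \<ge> 1" and c: "c \<in> carrier_vec q"
      by (auto simp: T_def)
    \<comment> \<open>An arbitrary column F c is the combination of the columns of F with the
      entries of c as right scalars.\<close>
    have "v = vec p (\<lambda>i. \<Sum>j<q. shift_column F n (unit_vec q j) $ i * fps_const (c $ j))"
      using shift_column_carrier[OF F]
      by (intro eq_vecI) (auto simp: v shift_column_nth[OF F c] shift_column_unit_nth[OF F])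
    also have "\<dots> \<in> right_span p S"
      using n by (intro right_span_sum[OF S] unit) auto
    finally show "v \<in> right_span p S" .
  qed
  then have "right_span p S = right_span p T"
    using right_span_minimal[OF S, of T] right_span_minimal[OF T, of S] ST right_span_base[OF T]
    by blast
  moreover have "finite S"
    by (simp add: S_def)
  ultimately show ?thesis
    using ST right_span_base[OF T]
    unfolding right_finitely_generated_def shift_module_eq T_def[symmetric] by blast
qed

theorem theorem5p14:
  fixes F :: "grassmann fps mat" and p q :: nat
  assumes "p \<ge> 1" and "q \<ge> 1" and "F \<in> Gamma p q"
  shows "(entries_star_rational p q F \<longleftrightarrow> polynomial_fraction p q F) \<and>
    (polynomial_fraction p q F \<longleftrightarrow> has_realization p q F) \<and>
    (has_realization p q F \<longleftrightarrow> has_coefficient_formula p q F) \<and>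
    (has_coefficient_formula p q F \<longleftrightarrow> right_finitely_generated p (shift_module p q F))"
proof -
  have F: "F \<in> carrier_mat p q"
    using assms(3) by (simp add: Gamma_def)
  \<comment> \<open>Star-rationality is equivalent to being a fraction, and it closes a cycle
    through finite generation, the coefficient formula and realizability.\<close>
  show ?thesis
    using polynomial_fraction_imp_star_rational[of p q F]
      star_rational_imp_polynomial_fraction[OF F assms(2)]
      star_rational_imp_finitely_generated[OF F] finitely_generated_imp_coefficient_formula[OF F]
      realization_iff_coefficient_formula[OF F] realization_imp_star_rational[of p q F]
    by blast
qed

end
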